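(* Let $r,s,t\ge1$ and $D\ge3$ be integers and let $\mathcal G=\{G_1,\dots,G_t\}$ be an $s$-joined graph family on $n$ vertices. Let $H_0$ be a forest with $r$ components, the $i$-th containing the single root $h_i$ ($i\in[r]$), and let $H$ be an $H_0$-path-constructible graph whose paths all have length at least $2\lceil\log s/\log(D-1)\rceil+3$, with $|V(H)|\le n-6sD$. Then for every $[t]$-edge-coloring $\mathcal H$ of $H$ with $\Delta^{mon}(\mathcal H)\le D$, there exist $W\subseteq V'\subseteq V(\mathcal G)$ with $|V'|\ge n-s$ and $|W|\ge n-3sD-5s$ such that for any distinct $v_1,\dots,v_r\in W$ there is a root set for $\mathcal H$ containing $h_1,\dots,h_r$ making it a rooted graph and a $(2s,D)$-good embedding $\phi:\mathcal H\hookrightarrow\mathcal G[V']$ with $\phi(h_i)=v_i$ for all $i\in[r]$.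
   Context: A graph family $\mathcal G=\{G_1,\dots,G_t\}$ is a collection of $t$ simple graphs on a common finite vertex set $V$, $n=|V|$. For $X\subseteq V\times[t]$, $\Gamma_{\mathcal G}(X)=\bigcup_{(v,i)\in X}\{u\in V:uv\in E(G_i)\}$. The family is $s$-joined if for all $X\subseteq V\times[t]$ and $Y\subseteq V$ with $|X|\ge s$ and $|Y|\ge s$ there exist $(v,i)\in X$ and $y\in Y$ with $vy\in E(G_i)$. For $V'\subseteq V$, $\mathcal G[V']=\{G_1[V'],\dots,G_t[V']\}$. A $[t]$-edge-colored graph $\mathcal H$ is a simple graph with each edge colored in $[t]$; $H_i$ is its spanning subgraph of color-$i$ edges, $\deg_{H_i}(h)$ the number of color-$i$ edges at $h$, and $\Delta^{mon}(\mathcal H)=\max_i\max_h\deg_{H_i}(h)$. An embedding $\phi:\mathcal H\hookrightarrow\mathcal G$ is an injective map $V(\mathcal H)\to V$ with $\phi(x)\phi(y)\in E(G_i)$ for every edge $xy$ of color $i$. A rooted $[t]$-edge-colored graph is one with a distinguished set of roots such that, after deleting all edges with both ends roots, every connected component is a tree containing exactly one root; for a non-root $h$, $c(h)$ is the color of the edge from $h$ to its parent (its neighbour on the unique path from $h$ to the root set). For fixed $D$ and an embedding $\phi$ into a family on vertex set $V$: $P_\phi(\mathcal H)=\{(\phi(h),c(h)):h\text{ non-root}\}$ and $R(X,\phi)=|\Gamma_{\mathcal G}(X)\setminus\phi(V(\mathcal H))|-\sum_{(v,i)\in X}[D-\deg_{H_i}(\phi^{-1}(v))]-|P_\phi(\mathcal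 H)\cap X|$ for $X\subseteq V\times[t]$, with $\deg_{H_i}(\phi^{-1}(v))=0$ if $v\notin\phi(V(\mathcal H))$; $\phi$ is $(s,D)$-good if $R(X,\phi)\ge0$ whenever $|X|\le s$. For $H_0\subseteq H$, $H$ is $H_0$-path-constructible if there are edge-disjoint paths $P_1,\dots,P_k$ in $H$ such that (i) $E(H)=E(H_0)\cup\bigcup_{j}E(P_j)$; (ii) for each $i$ the internal vertices of $P_i$ avoid $V(H_0)\cup\bigcup_{j<i}V(P_j)$; (iii) for each $i$ at least one endpoint of $P_i$ lies in $V(H_0)\cup\bigcup_{j<i}V(P_j)$. *)

theory Defs
  imports Complex_Main
begin

definition simple_graph :: "'a set \<Rightarrow> 'a set set \<Rightarrow> bool" where
  "simple_graph V E \<longleftrightarrow> finite V \<and>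
     (\<forall>e\<in>E. \<exists>x y. x \<noteq> y \<and> e = {x, y} \<and> x \<in> V \<and> y \<in> V)"

definition walk_in :: "'a set set \<Rightarrow> 'a list \<Rightarrow> bool" where
  "walk_in E xs \<longleftrightarrow> xs \<noteq> [] \<and> (\<forall>j. Suc j < length xs \<longrightarrow> {xs ! j, xs ! Suc j} \<in> E)"

definition path_in :: "'a set set \<Rightarrow> 'a list \<Rightarrow> bool" where
  "path_in E xs \<longleftrightarrow> walk_in E xs \<and> distinct xs"

definition path_edges :: "'a list \<Rightarrow> 'a set set" where
  "path_edges xs = {{xs ! j, xs ! Suc j} | j. Suc j < length xs}"

definition comp :: "'a set \<Rightarrow> 'a set set \<Rightarrow> 'a \<Rightarrow> 'a set" where
  "comp V E x = {y. \<exists>xs. walk_in E xs \<and> set xs \<subseteq> V \<and> hd xs = x \<and> last xs = y}"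

definition cycle_on :: "'a set \<Rightarrow> 'a set set \<Rightarrow> 'a list \<Rightarrow> bool" where
  "cycle_on C E xs \<longleftrightarrow> length xs \<ge> 3 \<and> path_in E xs \<and> set xs \<subseteq> C \<and> {last xs, hd xs} \<in> E"

definition acyclic_on :: "'a set \<Rightarrow> 'a set set \<Rightarrow> bool" where
  "acyclic_on C E \<longleftrightarrow> \<not> (\<exists>xs. cycle_on C E xs)"

definition is_tree_on :: "'a set \<Rightarrow> 'a set set \<Rightarrow> bool" where
  "is_tree_on C E \<longleftrightarrow> C \<noteq> {} \<and>
     (\<forall>x\<in>C. \<forall>y\<in>C. \<exists>xs. walk_in E xs \<and> set xs \<subseteq> C \<and> hd xs = x \<and> last xs = y)
     \<and> acyclic_on C E"

definition graph_family :: "'v set \<Rightarrow> nat \<Rightarrow> (nat \<Rightarrow> 'v \<Rightarrow> 'v \<Rightarrow> bool) \<Rightarrow> bool" where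
  "graph_family V t G \<longleftrightarrow> finite V \<and>
     (\<forall>i\<in>{1..t}. \<forall>u v. G i u v \<longrightarrow> u \<in> V \<and> v \<in> V \<and> u \<noteq> v \<and> G i v u)"

definition Gamma :: "'v set \<Rightarrow> (nat \<Rightarrow> 'v \<Rightarrow> 'v \<Rightarrow> bool) \<Rightarrow> ('v \<times> nat) set \<Rightarrow> 'v set" where
  "Gamma V G X = {u \<in> V. \<exists>(v, i)\<in>X. G i v u}"

definition s_joined :: "'v set \<Rightarrow> nat \<Rightarrow> (nat \<Rightarrow> 'v \<Rightarrow> 'v \<Rightarrow> bool) \<Rightarrow> nat \<Rightarrow> bool" where
  "s_joined V t G s \<longleftrightarrow> (\<forall>X Y. X \<subseteq> V \<times> {1..t} \<longrightarrow> Y \<subseteq> V \<longrightarrow> card X \<ge> s \<longrightarrow> card Y \<ge> s \<longrightarrow>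
      (\<exists>(v, i)\<in>X. \<exists>y\<in>Y. G i v y))"

definition restrict_fam :: "(nat \<Rightarrow> 'v \<Rightarrow> 'v \<Rightarrow> bool) \<Rightarrow> 'v set \<Rightarrow> (nat \<Rightarrow> 'v \<Rightarrow> 'v \<Rightarrow> bool)" where
  "restrict_fam G V' = (\<lambda>i u v. G i u v \<and> u \<in> V' \<and> v \<in> V')"

definition edge_coloring :: "'h set \<Rightarrow> 'h set set \<Rightarrow> nat \<Rightarrow> ('h set \<Rightarrow> nat) \<Rightarrow> bool" where
  "edge_coloring VH EH t col \<longleftrightarrow> simple_graph VH EH \<and> (\<forall>e\<in>EH. col e \<in> {1..t})"

definition deg_col :: "'h set set \<Rightarrow> ('h set \<Rightarrow> nat) \<Rightarrow> nat \<Rightarrow> 'h \<Rightarrow> nat" where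
  "deg_col EH col i h = card {e \<in> EH. h \<in> e \<and> col e = i}"

definition max_mon_deg_le :: "'h set \<Rightarrow> 'h set set \<Rightarrow> nat \<Rightarrow> ('h set \<Rightarrow> nat) \<Rightarrow> nat \<Rightarrow> bool" where
  "max_mon_deg_le VH EH t col D \<longleftrightarrow> (\<forall>i\<in>{1..t}. \<forall>h\<in>VH. deg_col EH col i h \<le> D)"

definition nonroot_edges :: "'h set set \<Rightarrow> 'h set \<Rightarrow> 'h set set" where
  "nonroot_edges EH R = {e \<in> EH. \<not> e \<subseteq> R}"

definition rooted :: "'h set \<Rightarrow> 'h set set \<Rightarrow> 'h set \<Rightarrow> bool" where
  "rooted VH EH R \<longleftrightarrow> R \<subseteq> VH \<and>
     (\<forall>x\<in>VH. is_tree_on (comp VH (nonroot_edges EH R) x) (nonroot_edges EH R)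
             \<and> card (comp VH (nonroot_edges EH R) x \<inter> R) = 1)"

text \<open>the parent of a non-root h: its neighbour on the unique path from h to the root set\<close>
definition parent :: "'h set \<Rightarrow> 'h set set \<Rightarrow> 'h set \<Rightarrow> 'h \<Rightarrow> 'h" where
  "parent VH EH R h = (THE p. \<exists>xs. path_in (nonroot_edges EH R) xs \<and> set xs \<subseteq> VH \<and>
       length xs \<ge> 2 \<and> hd xs = h \<and> last xs \<in> R \<and> set (butlast xs) \<inter> R = {} \<and> xs ! 1 = p)"

definition cpar :: "'h set \<Rightarrow> 'h set set \<Rightarrow> ('h set \<Rightarrow> nat) \<Rightarrow> 'h set \<Rightarrow> 'h \<Rightarrow> nat" where
  "cpar VH EH col R h = col {h, parent VH EH R h}"

definition embedding :: "'h set \<Rightarrow> 'h set set \<Rightarrow> ('h set \<Rightarrow> nat) \<Rightarrow> 'v set \<Rightarrow>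
    (nat \<Rightarrow> 'v \<Rightarrow> 'v \<Rightarrow> bool) \<Rightarrow> ('h \<Rightarrow> 'v) \<Rightarrow> bool" where
  "embedding VH EH col V G \<phi> \<longleftrightarrow> inj_on \<phi> VH \<and> \<phi> ` VH \<subseteq> V \<and>
     (\<forall>e\<in>EH. \<forall>x y. e = {x, y} \<longrightarrow> G (col e) (\<phi> x) (\<phi> y))"

definition P_set :: "'h set \<Rightarrow> 'h set set \<Rightarrow> ('h set \<Rightarrow> nat) \<Rightarrow> 'h set \<Rightarrow> ('h \<Rightarrow> 'v) \<Rightarrow> ('v \<times> nat) set" where
  "P_set VH EH col R \<phi> = {(\<phi> h, cpar VH EH col R h) | h. h \<in> VH - R}"

definition deg_img :: "'h set \<Rightarrow> 'h set set \<Rightarrow> ('h set \<Rightarrow> nat) \<Rightarrow> ('h \<Rightarrow> 'v) \<Rightarrow> 'v \<Rightarrow> nat \<Rightarrow> nat" where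
  "deg_img VH EH col \<phi> v i =
     (if v \<in> \<phi> ` VH then deg_col EH col i (inv_into VH \<phi> v) else 0)"

definition R_val :: "nat \<Rightarrow> 'v set \<Rightarrow> (nat \<Rightarrow> 'v \<Rightarrow> 'v \<Rightarrow> bool) \<Rightarrow> 'h set \<Rightarrow> 'h set set \<Rightarrow>
    ('h set \<Rightarrow> nat) \<Rightarrow> 'h set \<Rightarrow> ('h \<Rightarrow> 'v) \<Rightarrow> ('v \<times> nat) set \<Rightarrow> int" where
  "R_val D V G VH EH col R \<phi> X =
     int (card (Gamma V G X - \<phi> ` VH))
     - (\<Sum>(v, i)\<in>X. int D - int (deg_img VH EH col \<phi> v i))
     - int (card (P_set VH EH col R \<phi> \<inter> X))"

definition good :: "nat \<Rightarrow> nat \<Rightarrow> nat \<Rightarrow> 'v set \<Rightarrow> (nat \<Rightarrow> 'v \<Rightarrow> 'v \<Rightarrow> bool) \<Rightarrow> 'h set \<Rightarrow> 'h set set \<Rightarrow>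
    ('h set \<Rightarrow> nat) \<Rightarrow> 'h set \<Rightarrow> ('h \<Rightarrow> 'v) \<Rightarrow> bool" where
  "good s D t V G VH EH col R \<phi> \<longleftrightarrow>
     (\<forall>X. X \<subseteq> V \<times> {1..t} \<longrightarrow> card X \<le> s \<longrightarrow> R_val D V G VH EH col R \<phi> X \<ge> 0)"

definition path_construction :: "'h set \<Rightarrow> 'h set set \<Rightarrow> 'h set \<Rightarrow> 'h set set \<Rightarrow> 'h list list \<Rightarrow> bool" where
  "path_construction V0 E0 VH EH Ps \<longleftrightarrow>
     (\<forall>p\<in>set Ps. path_in EH p \<and> set p \<subseteq> VH \<and> length p \<ge> 2) \<and>
     (\<forall>i<length Ps. \<forall>j<length Ps. i \<noteq> j \<longrightarrow> path_edges (Ps ! i) \<inter> path_edges (Ps ! j) = {}) \<and>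
     EH = E0 \<union> (\<Union>p\<in>set Ps. path_edges p) \<and>
     (\<forall>i<length Ps. set (butlast (tl (Ps ! i))) \<inter> (V0 \<union> (\<Union>j<i. set (Ps ! j))) = {}) \<and>
     (\<forall>i<length Ps. hd (Ps ! i) \<in> V0 \<union> (\<Union>j<i. set (Ps ! j))
                  \<or> last (Ps ! i) \<in> V0 \<union> (\<Union>j<i. set (Ps ! j)))"

end

theory Submission
  imports Defs
begin

text \<open>
  Fix a set \<open>Z\<close> of \<open>2sD + 3s\<close> vertices. Deleting a largest small set of slots that expands badly into
  \<open>Z\<close> leaves \<open>V'\<close>, in which every small set of slots expands by the factor \<open>D\<close> into \<open>Z\<close>; hence any
  placement of the roots in \<open>W = V' - Z\<close> is good. From there the forest is grown leaf by leaf with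
  the Friedman--Pippenger argument. A path between two embedded vertices is found by growing from both
  ends trees with at least \<open>s\<close> leaves, joining two leaves by an edge of the missing colour, and
  rolling back the unused branches, which preserves goodness. Turning a non-root into a root only
  shrinks \<open>P\<close>, so in the end all vertices of the coloured graph are declared roots.
\<close>

text \<open>Goodness concerns up to \<open>2s\<close> slots because the extension argument takes
  unions of two tight sets. Joinedness alone gives strict slack to sets of \<open>s\<close> to
  \<open>2s\<close> slots, so tight sets have fewer than \<open>s\<close> slots and the union of two
  of them is still covered.

  A connecting path cannot be steered: extension yields some free neighbour, never a prescribed one.
  Joinedness closes a gap only between \<open>s\<close> slots and \<open>s\<close> vertices, whence
  the trees. At either end just one unit of demand is guaranteed, so each tree starts with a single
  edge; \<open>k\<close>, the logarithm of \<open>s\<close> to base \<open>D - 1\<close> rounded up,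
  is the number of branchings after which there are \<open>s\<close> leaves. One edge and
  \<open>k\<close> levels at both ends plus the joining edge give the minimal length
  \<open>2k + 3\<close>.

  Besides the path itself the two trees occupy at most \<open>4 (D - 1) s\<close> vertices,
  temporarily. With \<open>2sD\<close> for the slack of large slot sets and \<open>4s\<close> for
  deleted vertices and lower terms this makes \<open>6sD\<close>.

  Declaring every vertex a root is legitimate since all edges are then deleted and every component
  is a single vertex. It is also the strictest bookkeeping needed: each edge is charged at both of
  its ends.\<close>

locale joined_family =
  fixes U :: "'v set" and t s D :: nat and g :: "nat \<Rightarrow> 'v \<Rightarrow> 'v \<Rightarrow> bool"
  assumes family: "graph_family U t g" and joined: "s_joined U t g s"
    and s_pos: "1 \<le> s" and D_ge: "3 \<le> D"
begin

abbreviation slots :: "('v \<times> nat) set" where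
  "slots \<equiv> U \<times> {1..t}"

abbreviation nbh :: "('v \<times> nat) set \<Rightarrow> 'v set" where
  "nbh \<equiv> Gamma U g"

text \<open>\<open>w (v, i)\<close> is the number of colour-\<open>i\<close> edges still to be provided at \<open>v\<close>. The set \<open>P\<close> is
  absorbed in \<open>w\<close>: attaching a leaf lowers the demand of its parent but not that of the leaf.\<close>

definition expands :: "'v set \<Rightarrow> ('v \<times> nat \<Rightarrow> int) \<Rightarrow> bool" where
  "expands A w \<longleftrightarrow>
     (\<forall>X. X \<subseteq> slots \<longrightarrow> card X \<le> 2 * s \<longrightarrow> sum w X \<le> int (card (nbh X - A)))"

section \<open>Neighbourhoods of slot sets and one-vertex extension\<close>

lemma finite_U [simp]: "finite U"
  using family by (simp add: graph_family_def)

lemma finite_nbh [simp]: "finite (nbh X)"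
  by (simp add: Gamma_def)

lemma nbh_Un: "nbh (X \<union> Y) = nbh X \<union> nbh Y"
  by (auto simp: Gamma_def)

lemma nbh_empty [simp]: "nbh {} = {}"
  by (simp add: Gamma_def)

lemma nbh_mono: "X \<subseteq> Y \<Longrightarrow> nbh X \<subseteq> nbh Y"
  by (auto simp: Gamma_def)

lemma nbh_single: "y \<in> nbh {(u, c)} \<longleftrightarrow> y \<in> U \<and> g c u y"
  by (auto simp: Gamma_def)

lemma edge_sym: "c \<in> {1..t} \<Longrightarrow> g c u v \<Longrightarrow> g c v u"
  using family by (auto simp: graph_family_def)

text \<open>Otherwise \<open>s\<close> vertices lie outside the neighbourhood, and joinedness gives
  an edge from \<open>X\<close> to one of them.\<close>

lemma card_nbh_large:
  assumes "X \<subseteq> slots" "s \<le> card X"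
  shows "card U < card (nbh X) + s"
proof (rule ccontr)
  assume "\<not> ?thesis"
  moreover have "card (U - nbh X) = card U - card (nbh X)"
    by (rule card_Diff_subset) (auto simp: Gamma_def)
  ultimately have "s \<le> card (U - nbh X)" by simp
  then obtain v i y where "(v, i) \<in> X" "y \<in> U - nbh X" "g i v y"
    using joined assms unfolding s_joined_def by (smt (verit, best) Diff_subset case_prodE)
  then show False by (auto simp: Gamma_def)
qed

text \<open>Neighbourhoods commute with unions but only satisfy an inclusion for intersections,
  which is the direction that makes tight sets closed under union.\<close>

lemma card_nbh_submodular:
  "card (nbh (X \<union> Y) - A) + card (nbh (X \<inter> Y) - A) \<le> card (nbh X - A) + card (nbh Y - A)"
proof -
  have "nbh (X \<union> Y) - A = (nbh X - A) \<union> (nbh Y - A)"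
    by (auto simp: nbh_Un)
  moreover have "card (nbh (X \<inter> Y) - A) \<le> card ((nbh X - A) \<inter> (nbh Y - A))"
    by (rule card_mono) (auto simp: Gamma_def)
  moreover have "card (nbh X - A) + card (nbh Y - A)
      = card ((nbh X - A) \<union> (nbh Y - A)) + card ((nbh X - A) \<inter> (nbh Y - A))"
    by (rule card_Un_Int) auto
  ultimately show ?thesis by simp
qed

lemma expands_mono:
  assumes "expands A w" "\<And>p. p \<in> slots \<Longrightarrow> w' p \<le> w p"
  shows "expands A w'"
  unfolding expands_def
proof (intro allI impI)
  fix X assume X: "X \<subseteq> slots" "card X \<le> 2 * s"
  then have "sum w' X \<le> sum w X" by (intro sum_mono assms(2)) auto
  with X assms(1) show "sum w' X \<le> int (card (nbh X - A))"
    unfolding expands_def by (meson order_trans)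
qed

text \<open>The demand is at most \<open>2sD\<close>, while the neighbourhood misses fewer than
  \<open>s\<close> vertices of \<open>U\<close> and loses at most \<open>card A\<close> more. Hence
  no set in this range is tight.\<close>

lemma sum_less_card_nbh_large:
  assumes X: "X \<subseteq> slots" "s \<le> card X" "card X \<le> 2 * s"
    and w: "\<And>p. p \<in> slots \<Longrightarrow> w p \<le> int D"
    and A: "finite A" "card A + s + 2 * s * D \<le> card U"
  shows "sum w X < int (card (nbh X - A))"
proof -
  have "sum w X \<le> (\<Sum>p\<in>X. int D)"
    using X w by (intro sum_mono) auto
  also have "\<dots> = int (card X * D)" by simp
  also have "\<dots> \<le> int (2 * s * D)"
    using X(3) by (intro of_nat_mono mult_right_mono) auto
  also have "2 * s * D < card (nbh X) - card A"
    using card_nbh_large[OF X(1,2)] A by linarith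
  also have "\<dots> \<le> card (nbh X - A)"
    using A by (simp add: diff_card_le_card_Diff)
  finally show ?thesis by simp
qed

text \<open>If no neighbour of the slot \<open>p\<close> could be added, each would be blocked by a tight set avoiding
  \<open>p\<close>. Tight sets are small and hence closed under union, and adding \<open>p\<close> to the union of the blocking
  sets violates the expansion.\<close>

lemma expands_extend:
  assumes ex: "expands A w"
    and w: "\<And>p. p \<in> slots \<Longrightarrow> w p \<le> int D"
    and A: "finite A" "card A + s + 2 * s * D \<le> card U"
    and p: "p \<in> slots" "1 \<le> w p"
  obtains y where "y \<in> nbh {p} - A" "expands (insert y A) (w(p := w p - 1))"
proof -
  define tight where
    "tight X \<longleftrightarrow> X \<subseteq> slots \<and> card X < s \<and> p \<notin> X \<and> sum w X = int (card (nbh X - A))" for X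
  have fin: "finite X" if "X \<subseteq> slots" for X
    using that by (rule finite_subset) auto
  have tight_Un: "tight (X \<union> Y)" if X: "tight X" and Y: "tight Y" for X Y
  proof -
    have sl: "X \<union> Y \<subseteq> slots" "X \<inter> Y \<subseteq> slots" and le: "card (X \<union> Y) \<le> 2 * s" "card (X \<inter> Y) \<le> 2 * s"
      using X Y card_Un_le[of X Y] card_mono[of X "X \<inter> Y"] fin[of X] by (auto simp: tight_def)
    have "sum w (X \<union> Y) + sum w (X \<inter> Y) = sum w X + sum w Y"
      using X Y fin by (intro sum.union_inter) (auto simp: tight_def)
    moreover have "sum w (X \<inter> Y) \<le> int (card (nbh (X \<inter> Y) - A))"
      using ex sl(2) le(2) by (simp add: expands_def)
    moreover have le2: "sum w (X \<union> Y) \<le> int (card (nbh (X \<union> Y) - A))"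
      using ex sl(1) le(1) by (simp add: expands_def)
    \<comment> \<open>The demands of union and intersection add up to those of \<open>X\<close> and
      \<open>Y\<close>, which equal their neighbourhoods by tightness. Submodularity leaves no room
      for strict inequality in either of the two bounds.\<close>
    ultimately have eq: "sum w (X \<union> Y) = int (card (nbh (X \<union> Y) - A))"
      using card_nbh_submodular[of X Y A] X Y by (simp add: tight_def)
    then have "card (X \<union> Y) < s"
      using sum_less_card_nbh_large[OF sl(1) _ le(1) w A] by fastforce
    then show ?thesis using eq sl X Y by (auto simp: tight_def)
  qed
  show thesis
  proof (rule ccontr)
    assume "\<not> thesis"
    with that have contra: "\<And>y. y \<in> nbh {p} - A \<Longrightarrow> \<not> expands (insert y A) (w(p := w p - 1))"
      by blast
    have "\<exists>X. tight X \<and> y \<in> nbh X" if y: "y \<in> nbh {p} - A" for y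
    proof -
      from contra[OF y] obtain X where X: "X \<subseteq> slots" "card X \<le> 2 * s"
        and bad: "int (card (nbh X - insert y A)) < sum (w(p := w p - 1)) X"
        by (auto simp: expands_def not_le)
      have old: "sum w X \<le> int (card (nbh X - A))"
        using ex X by (simp add: expands_def)
      have eq: "nbh X - insert y A = nbh X - A - {y}" by auto
      have sum': "sum (w(p := w p - 1)) X = sum w X - (if p \<in> X then 1 else 0)"
      proof (cases "p \<in> X")
        case True
        then show ?thesis
          using fin[OF X(1)] by (simp add: sum.remove[of X p])
      next
        case False
        then have "sum (w(p := w p - 1)) X = sum w X" by (intro sum.cong) auto
        with False show ?thesis by simp
      qed
      have yX: "y \<in> nbh X"
      proof (rule ccontr)
        assume "y \<notin> nbh X"
        then have "nbh X - insert y A = nbh X - A" by auto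
        then show False using bad old sum' by (simp split: if_splits)
      qed
      then have cd: "int (card (nbh X - insert y A)) = int (card (nbh X - A)) - 1"
        unfolding eq using y by (subst card_Suc_Diff1[of "nbh X - A" y, symmetric]) auto
      \<comment> \<open>Inside \<open>X\<close> the lowered demand at \<open>p\<close> would make up
        for the loss of \<open>y\<close>.\<close>
      have "p \<notin> X" using bad old sum' cd by (auto split: if_splits)
      then have "sum w X = int (card (nbh X - A))" using bad old sum' cd by auto
      moreover from this have "card X < s"
        using sum_less_card_nbh_large[OF X(1) _ X(2) w A] by fastforce
      ultimately show ?thesis using X yX \<open>p \<notin> X\<close> by (auto simp: tight_def)
    qed
    then obtain B where B: "\<And>y. y \<in> nbh {p} - A \<Longrightarrow> tight (B y) \<and> y \<in> nbh (B y)"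
      by metis
    have tU: "tight (\<Union>y\<in>Y. B y)" if "finite Y" "Y \<subseteq> nbh {p} - A" for Y
      using that
    proof (induction Y rule: finite_induct)
      case empty
      then show ?case using s_pos by (simp add: tight_def)
    next
      case (insert x F)
      then have "tight (B x \<union> (\<Union>y\<in>F. B y))" using B by (intro tight_Un) auto
      then show ?case by simp
    qed
    \<comment> \<open>If \<open>p\<close> has no free neighbour at all, this union is empty; the
      contradiction then comes from \<open>1 \<le> w p\<close> alone.\<close>
    define X where "X = (\<Union>y\<in>nbh {p} - A. B y)"
    have X: "tight X" unfolding X_def by (rule tU) auto
    have "nbh {p} - A \<subseteq> nbh X"
    proof
      fix y assume y: "y \<in> nbh {p} - A"
      then have "nbh (B y) \<subseteq> nbh X" unfolding X_def by (intro nbh_mono) auto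
      then show "y \<in> nbh X" using B[OF y] by auto
    qed
    then have "nbh (insert p X) - A = nbh X - A"
      using nbh_Un[of "{p}" X] by auto
    moreover have "sum w (insert p X) = w p + sum w X"
      using X fin by (intro sum.insert) (auto simp: tight_def)
    moreover have "sum w (insert p X) \<le> int (card (nbh (insert p X) - A))"
    proof -
      have "insert p X \<subseteq> slots" using X p by (auto simp: tight_def)
      moreover have "card (insert p X) \<le> 2 * s"
        using X fin[of X] by (auto simp: tight_def card_insert_if)
      ultimately show ?thesis using ex by (simp add: expands_def)
    qed
    ultimately show False using X p(2) by (simp add: tight_def)
  qed
qed

section \<open>Forests grown from an occupied set, and their rollback\<close>

definition children :: "('v \<Rightarrow> 'v \<times> nat) \<Rightarrow> 'v set \<Rightarrow> 'v \<times> nat \<Rightarrow> int" where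
  "children par T p = int (card {y \<in> T. par y = p})"

text \<open>\<open>T\<close> is the set of new vertices of a forest grown from \<open>A\<close>; a new vertex \<open>y\<close> hangs from the
  vertex \<open>fst (par y)\<close> by an edge of colour \<open>snd (par y)\<close>.\<close>

definition grown :: "'v set \<Rightarrow> ('v \<times> nat \<Rightarrow> int) \<Rightarrow> 'v set \<Rightarrow> ('v \<Rightarrow> 'v \<times> nat) \<Rightarrow> bool" where
  "grown A w T par \<longleftrightarrow> T \<subseteq> U - A \<and> (\<forall>y\<in>T. par y \<in> slots \<and> y \<in> nbh {par y})
     \<and> expands (A \<union> T) (\<lambda>p. w p - children par T p)"

text \<open>Dropping \<open>y\<close> returns one unit of demand to its parent slot, but every
  \<open>X\<close> containing that slot also regains \<open>y\<close> as a free neighbour. No parent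
  is required to lie in \<open>A \<union> T\<close>, so \<open>T'\<close> may be any subset, not
  only one closed under parents.\<close>

lemma grown_rollback:
  assumes gr: "grown A w T par" and T': "T' \<subseteq> T"
  shows "grown A w T' par"
proof -
  have "expands (A \<union> T') (\<lambda>p. w p - children par T' p)"
    unfolding expands_def
  proof (intro allI impI)
    fix X assume X: "X \<subseteq> slots" "card X \<le> 2 * s"
    have finT: "finite T" using gr by (meson finite_Diff finite_U finite_subset grown_def)
    have finX: "finite X" using X(1) by (rule finite_subset) auto
    have ch: "(\<Sum>p\<in>X. children par S p) = int (card {y \<in> S. par y \<in> X})" if "S \<subseteq> T" for S
    proof -
      have "finite S" using that finT by (rule finite_subset)
      have "{y \<in> S. par y \<in> X} = (\<Union>p\<in>X. {y \<in> S. par y = p})" by auto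
      then have "card {y \<in> S. par y \<in> X} = (\<Sum>p\<in>X. card {y \<in> S. par y = p})"
        using finX \<open>finite S\<close> by (simp only:) (subst card_UN_disjoint, auto)
      then show ?thesis by (simp add: children_def)
    qed
    have "sum w X - int (card {y \<in> T. par y \<in> X}) \<le> int (card (nbh X - (A \<union> T)))"
    proof -
      have "(\<Sum>p\<in>X. w p - children par T p) \<le> int (card (nbh X - (A \<union> T)))"
        using gr X unfolding grown_def expands_def by blast
      then show ?thesis by (simp add: sum_subtractf ch)
    qed
    moreover have "card {y \<in> T. par y \<in> X} \<le> card {y \<in> T'. par y \<in> X} + card {y \<in> T - T'. par y \<in> X}"
      using T' by (intro order_trans[OF eq_refl card_Un_le] arg_cong[where f = card]) auto
    moreover have "card (nbh X - (A \<union> T)) + card {y \<in> T - T'. par y \<in> X} \<le> card (nbh X - (A \<union> T'))"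
    proof -
      have "y \<in> nbh X - (A \<union> T')" if "y \<in> T - T'" "par y \<in> X" for y
        using that gr nbh_mono[of "{par y}" X] by (auto simp: grown_def)
      then have "(nbh X - (A \<union> T)) \<union> {y \<in> T - T'. par y \<in> X} \<subseteq> nbh X - (A \<union> T')"
        using T' by auto
      then have "card ((nbh X - (A \<union> T)) \<union> {y \<in> T - T'. par y \<in> X}) \<le> card (nbh X - (A \<union> T'))"
        by (intro card_mono) auto
      then show ?thesis using finT by (subst (asm) card_Un_disjoint) auto
    qed
    ultimately show "(\<Sum>p\<in>X. w p - children par T' p) \<le> int (card (nbh X - (A \<union> T')))"
      by (simp add: sum_subtractf ch T')
  qed
  then show ?thesis using gr T' by (auto simp: grown_def)
qed

text \<open>This is \<open>expands_extend\<close> for the residual demand; the new leaf keeps its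
  whole demand, since only the slot of its parent gains a child.\<close>

lemma grown_extend:
  assumes gr: "grown A w T par"
    and w: "\<And>p. p \<in> slots \<Longrightarrow> w p \<le> int D"
    and A: "finite A" "card A + card T + s + 2 * s * D \<le> card U"
    and p: "p \<in> slots" "1 \<le> w p - children par T p"
  obtains y where "y \<in> U - (A \<union> T)" "grown A w (insert y T) (par(y := p))"
proof -
  have T: "T \<subseteq> U - A" and finT: "finite T"
    using gr by (auto simp: grown_def intro: finite_subset[OF _ finite_U])
  have "card (A \<union> T) + s + 2 * s * D \<le> card U"
    using A card_Un_le[of A T] by linarith
  moreover have "expands (A \<union> T) (\<lambda>p. w p - children par T p)"
    using gr by (simp add: grown_def)
  moreover have "w q - children par T q \<le> int D" if "q \<in> slots" for q
    using w[OF that] by (simp add: children_def)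
  ultimately obtain y where y: "y \<in> nbh {p} - (A \<union> T)"
    and ex: "expands (insert y (A \<union> T))
       ((\<lambda>p. w p - children par T p)(p := w p - children par T p - 1))"
    using expands_extend[of "A \<union> T" "\<lambda>p. w p - children par T p" p] p A(1) finT by auto
  have "children (par(y := p)) (insert y T) q = children par T q + (if q = p then 1 else 0)" for q
  proof -
    have "{z \<in> insert y T. (par(y := p)) z = q}
        = (if q = p then insert y {z \<in> T. par z = q} else {z \<in> T. par z = q})"
      using y by auto
    then show ?thesis using y finT by (simp add: children_def)
  qed
  then have "expands (A \<union> insert y T) (\<lambda>q. w q - children (par(y := p)) (insert y T) q)"
    using ex by (simp add: fun_upd_def) (smt (verit) expands_mono)
  then have "grown A w (insert y T) (par(y := p))"
    using gr y p by (auto simp: grown_def Gamma_def)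
  moreover have "y \<in> U - (A \<union> T)" using y by (auto simp: Gamma_def)
  ultimately show thesis using that by blast
qed

end

section \<open>Trees with prescribed colours, and paths cut out of them\<close>

text \<open>In use \<open>z\<close> has one entry more than \<open>cs\<close>, and
  \<open>cs ! j\<close> is the colour of the edge from \<open>z ! j\<close> to
  \<open>z ! Suc j\<close>. Both ends of an edge are charged, whereas \<open>children\<close>
  charges only the upper one.\<close>

definition path_deg :: "'a list \<Rightarrow> nat list \<Rightarrow> 'a \<Rightarrow> nat \<Rightarrow> nat" where
  "path_deg z cs v i = card {j. j < length cs \<and> cs ! j = i \<and> (v = z ! j \<or> v = z ! Suc j)}"

text \<open>The start \<open>u\<close> is already occupied and therefore left out of
  \<open>ys\<close>; what remains is exactly the set of vertices to be kept in a rollback.\<close>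

definition tree_path :: "('a \<Rightarrow> 'a \<times> nat) \<Rightarrow> 'a \<Rightarrow> nat list \<Rightarrow> 'a list \<Rightarrow> bool" where
  "tree_path par u cs ys \<longleftrightarrow> length ys = length cs \<and> distinct ys
     \<and> (\<forall>i < length cs. par (ys ! i) = ((u # ys) ! i, cs ! i))"

text \<open>Size of a tree that is a bare path for \<open>q\<close> levels, where the truncated
  exponent \<open>j - q\<close> is 0, and then branches \<open>Q\<close>-fold \<open>k\<close>
  times. The geometric part is at most twice its last level.\<close>

lemma sum_levels_le:
  fixes Q :: nat
  assumes "2 \<le> Q"
  shows "(\<Sum>j=1..q + k. Q ^ (j - q)) \<le> q + 2 * Q ^ k"
proof (induction k)
  case 0
  have "(\<Sum>j=1..q. Q ^ (j - q)) = (\<Sum>j=1..q. 1)" by (intro sum.cong) auto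
  then show ?case by simp
next
  case (Suc k)
  have "2 * Q ^ k \<le> Q ^ Suc k" using assms by simp
  moreover have "(\<Sum>j=1..q + Suc k. Q ^ (j - q)) = (\<Sum>j=1..q + k. Q ^ (j - q)) + Q ^ Suc k"
    by simp
  ultimately show ?case using Suc.IH by linarith
qed

context joined_family
begin

text \<open>By pigeonhole, as long as fewer than \<open>b * card L\<close> vertices have been hung
  below \<open>L\<close>, some vertex of \<open>L\<close> has received fewer than \<open>b\<close>
  and still has demand.\<close>

lemma grow_level:
  assumes gr: "grown A w T par"
    and w: "\<And>p. p \<in> slots \<Longrightarrow> w p \<le> int D"
    and A: "finite A" "card A + card T + N + s + 2 * s * D \<le> card U"
    and L: "L \<subseteq> U" "c \<in> {1..t}" "\<And>l. l \<in> L \<Longrightarrow> int b \<le> w (l, c) - children par T (l, c)"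
    and N: "N \<le> b * card L"
  shows "\<exists>T' par'. grown A w T' par' \<and> T \<subseteq> T' \<and> (\<forall>y\<in>T. par' y = par y) \<and> card (T' - T) = N
    \<and> (\<forall>y\<in>T' - T. par' y \<in> L \<times> {c})"
  using A(2) N
proof (induction N)
  case 0
  then show ?case using gr by (intro exI[of _ T] exI[of _ par]) auto
next
  case (Suc N)
  then obtain T' par' where gr': "grown A w T' par'" and sub: "T \<subseteq> T'"
    and ag: "\<forall>y\<in>T. par' y = par y" and cd: "card (T' - T) = N"
    and new: "\<forall>y\<in>T' - T. par' y \<in> L \<times> {c}"
    by auto
  have finT': "finite T'"
    using gr' by (auto simp: grown_def intro: finite_subset[OF _ finite_U])
  have finL: "finite L" using L(1) by (rule finite_subset) simp
  have "\<exists>l\<in>L. card {y \<in> T' - T. par' y = (l, c)} < b"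
  proof (rule ccontr)
    assume "\<not> ?thesis"
    then have "(\<Sum>l\<in>L. b) \<le> (\<Sum>l\<in>L. card {y \<in> T' - T. par' y = (l, c)})"
      by (intro sum_mono) (auto simp: not_less)
    also have "\<dots> = card (\<Union>l\<in>L. {y \<in> T' - T. par' y = (l, c)})"
      using finL finT' by (subst card_UN_disjoint) auto
    also have "(\<Union>l\<in>L. {y \<in> T' - T. par' y = (l, c)}) = T' - T"
      using new by fastforce
    finally show False using cd Suc.prems by (simp add: mult.commute)
  qed
  then obtain l where l: "l \<in> L" "card {y \<in> T' - T. par' y = (l, c)} < b" by auto
  have "card {y \<in> T'. par' y = (l, c)}
      \<le> card {y \<in> T. par y = (l, c)} + card {y \<in> T' - T. par' y = (l, c)}"
    using sub ag by (intro order_trans[OF eq_refl card_Un_le] arg_cong[where f = card]) auto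
  then have cap: "1 \<le> w (l, c) - children par' T' (l, c)"
    using l L(3)[OF l(1)] by (simp add: children_def)
  have cdT': "card T' = card T + N"
    using cd sub finT' by (metis card_Diff_subset card_mono finite_subset le_add_diff_inverse)
  obtain y where y: "y \<in> U - (A \<union> T')" "grown A w (insert y T') (par'(y := (l, c)))"
    using grown_extend[OF gr' w A(1) _ _ cap] Suc.prems(1) cdT' l(1) L by auto
  have "insert y T' - T = insert y (T' - T)" using y sub by auto
  then have "card (insert y T' - T) = Suc N" using y cd finT' by simp
  moreover have "\<forall>z\<in>T. (par'(y := (l, c))) z = par z" using ag y sub by auto
  moreover have "\<forall>z\<in>insert y T' - T. (par'(y := (l, c))) z \<in> L \<times> {c}" using new l by auto
  moreover have "T \<subseteq> insert y T'" using sub by auto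
  ultimately show ?case using y(2) by blast
qed

text \<open>All edges entering level \<open>j + 1\<close> get the colour \<open>cs ! j\<close>, so
  every branch spells the colour word \<open>cs\<close> and any last-level vertex can serve as the
  end of the path. The level sizes \<open>f\<close> are left open to cover both bare paths and
  branching trees.\<close>

lemma grow_tree:
  assumes ex: "expands A w"
    and w: "\<And>p. p \<in> slots \<Longrightarrow> w p \<le> int D"
    and off: "\<And>v i. v \<in> U - A \<Longrightarrow> i \<in> {1..t} \<Longrightarrow> w (v, i) = int D"
    and A: "A \<subseteq> U" "u \<in> A"
    and cs: "set cs \<subseteq> {1..t}" "cs \<noteq> []" "1 \<le> w (u, hd cs)"
    and f: "f 0 = 1" "f 1 = 1" "\<And>j. 1 \<le> j \<Longrightarrow> f (Suc j) \<le> (D - 1) * f j"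
    and room: "card A + (\<Sum>j=1..length cs. f j) + s + 2 * s * D \<le> card U"
  obtains T par L where "grown A w T par" "card T = (\<Sum>j=1..length cs. f j)"
    "card L = f (length cs)" "L \<subseteq> T" "\<And>y. y \<in> T \<Longrightarrow> fst (par y) \<in> insert u T"
    "\<And>l. l \<in> L \<Longrightarrow> \<exists>ys. tree_path par u cs ys \<and> set ys \<subseteq> T \<and> last ys = l"
proof -
  have finA: "finite A" using A(1) by (rule finite_subset) simp
  have "\<exists>T par L. grown A w T par \<and> card T = (\<Sum>i=1..j. f i) \<and> card L = f j
     \<and> (if j = 0 then L = {u} \<and> T = {} else L \<subseteq> T \<and> (\<forall>l\<in>L. \<forall>c. children par T (l, c) = 0))
     \<and> (\<forall>y\<in>T. fst (par y) \<in> insert u T)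
     \<and> (\<forall>l\<in>L. \<exists>ys. tree_path par u (take j cs) ys \<and> set ys \<subseteq> T \<and> last (u # ys) = l)"
    if "j \<le> length cs" for j
    using that
  proof (induction j)
    case 0
    have "grown A w {} par" for par using ex by (simp add: grown_def children_def)
    then show ?case using f(1) by (intro exI[of _ "{}"] exI[of _ "{u}"]) (auto simp: tree_path_def)
  next
    case (Suc j)
    then obtain T par L where gr: "grown A w T par" and cdT: "card T = (\<Sum>i=1..j. f i)"
      and cdL: "card L = f j"
      and L: "if j = 0 then L = {u} \<and> T = {} else L \<subseteq> T \<and> (\<forall>l\<in>L. \<forall>c. children par T (l, c) = 0)"
      and anc: "\<forall>y\<in>T. fst (par y) \<in> insert u T"
      and paths: "\<forall>l\<in>L. \<exists>ys. tree_path par u (take j cs) ys \<and> set ys \<subseteq> T \<and> last (u # ys) = l"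
      by (auto simp del: last.simps)
    define c where "c = cs ! j"
    \<comment> \<open>The start may have a single unit of demand left. A new vertex offers
      \<open>D\<close>, of which \<open>D - 1\<close> is used, the base of the logarithm in the path
      length.\<close>
    define b where "b = (if j = 0 then 1 else D - 1)"
    have c: "c \<in> {1..t}" unfolding c_def using Suc.prems by (intro subsetD[OF cs(1)] nth_mem) simp
    have TU: "T \<subseteq> U - A" using gr by (simp add: grown_def)
    have LuT: "L \<subseteq> insert u T" using L by (auto split: if_splits)
    have "(\<Sum>i=1..Suc j. f i) \<le> (\<Sum>j=1..length cs. f j)"
      using Suc.prems by (intro sum_mono2) auto
    then have rm: "card A + card T + f (Suc j) + s + 2 * s * D \<le> card U"
      using room cdT by simp
    have cap: "int b \<le> w (l, c) - children par T (l, c)" if l: "l \<in> L" for l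
    proof (cases "j = 0")
      case True
      then show ?thesis using L l cs(2,3) by (auto simp: b_def c_def children_def hd_conv_nth)
    next
      case False
      then have "w (l, c) = int D" using L l TU c by (intro off) auto
      then show ?thesis using False L l by (simp add: b_def)
    qed
    have "f (Suc j) \<le> b * card L"
      using f(2) f(1) f(3)[of j] cdL by (auto simp: b_def)
    then obtain T' par' where gr': "grown A w T' par'" and sub: "T \<subseteq> T'"
      and ag: "\<forall>y\<in>T. par' y = par y" and cd: "card (T' - T) = f (Suc j)"
      and new: "\<forall>y\<in>T' - T. par' y \<in> L \<times> {c}"
      using grow_level[OF gr w finA rm _ c cap, of L] LuT TU A by blast
    have T'U: "T' \<subseteq> U - A" using gr' by (simp add: grown_def)
    have finT': "finite T'" using T'U by (auto intro: finite_subset[OF _ finite_U])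
    have "card T' = card T + f (Suc j)"
      using cd sub finT' by (metis card_Diff_subset card_mono finite_subset le_add_diff_inverse)
    then have cdT': "card T' = (\<Sum>i=1..Suc j. f i)" using cdT by simp
    have anc': "fst (par' y) \<in> insert u T" if "y \<in> T'" for y
    proof (cases "y \<in> T")
      case True
      then show ?thesis using anc ag by simp
    next
      case False
      then have "par' y \<in> L \<times> {c}" using new that by blast
      then have "fst (par' y) \<in> L" by auto
      then show ?thesis using LuT by blast
    qed
    have ch0: "children par' T' (l, i) = 0" if "l \<in> T' - T" for l i
    proof -
      have "{y \<in> T'. par' y = (l, i)} = {}"
        using anc' that T'U A(2) by fastforce
      then show ?thesis unfolding children_def by (simp only: card.empty of_nat_0)
    qed
    have pth: "\<exists>ys. tree_path par' u (take (Suc j) cs) ys \<and> set ys \<subseteq> T' \<and> last (u # ys) = l"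
      if l: "l \<in> T' - T" for l
    proof -
      have "par' l \<in> L \<times> {c}" using new l by blast
      then obtain l' where l': "l' \<in> L" "par' l = (l', c)" by auto
      then obtain ys where ys: "tree_path par u (take j cs) ys" "set ys \<subseteq> T" "last (u # ys) = l'"
        using paths by blast
      have len: "length ys = j" using ys(1) Suc.prems by (simp add: tree_path_def)
      have "(u # ys) ! j = l'"
        using ys(3) len by (metis last_conv_nth length_Cons diff_Suc_1 list.distinct(1))
      moreover have "par' (ys ! i) = ((u # ys) ! i, cs ! i)" if "i < j" for i
      proof -
        have "ys ! i \<in> T" using that len ys(2) by (metis nth_mem subsetD)
        then show ?thesis using ag ys(1) that Suc.prems by (simp add: tree_path_def)
      qed
      ultimately have "par' ((ys @ [l]) ! i) = ((u # ys @ [l]) ! i, cs ! i)" if "i < Suc j" for i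
        using that len l' by (cases "i = j") (auto simp: nth_append c_def nth_Cons split: nat.splits)
      then have "tree_path par' u (take (Suc j) cs) (ys @ [l])"
        using ys len l Suc.prems by (auto simp: tree_path_def)
      then show ?thesis using ys(2) l sub by (intro exI[of _ "ys @ [l]"]) auto
    qed
    have anc2: "\<forall>y\<in>T'. fst (par' y) \<in> insert u T'" using anc' sub by blast
    show ?case
      by (rule exI[of _ T'], rule exI[of _ par'], rule exI[of _ "T' - T"])
        (use gr' cdT' cd ch0 pth anc2 in \<open>simp del: last.simps\<close>)
  qed
  from this[of "length cs"] cs(2) obtain T par L where
    *: "grown A w T par" "card T = (\<Sum>j=1..length cs. f j)"
      "card L = f (length cs)" "L \<subseteq> T" "\<forall>y\<in>T. fst (par y) \<in> insert u T"
      "\<forall>l\<in>L. \<exists>ys. tree_path par u cs ys \<and> set ys \<subseteq> T \<and> last (u # ys) = l"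
    by (auto simp del: last.simps)
  have "\<exists>ys. tree_path par u cs ys \<and> set ys \<subseteq> T \<and> last ys = l" if l: "l \<in> L" for l
  proof -
    obtain ys where ys: "tree_path par u cs ys" "set ys \<subseteq> T" "last (u # ys) = l"
      using *(6) l by blast
    then have "ys \<noteq> []" using cs(2) by (auto simp: tree_path_def)
    then show ?thesis using ys by auto
  qed
  then show thesis using that * by blast
qed

lemma children_tree_path:
  assumes "tree_path par u cs ys"
  shows "children par (set ys) (v, c) = int (card {j. j < length cs \<and> cs ! j = c \<and> (u # ys) ! j = v})"
proof -
  have "bij_betw (\<lambda>j. ys ! j) {j. j < length cs \<and> cs ! j = c \<and> (u # ys) ! j = v}
      {y \<in> set ys. par y = (v, c)}"
    using assms
    by (auto simp: tree_path_def bij_betw_def inj_on_def nth_eq_iff_index_eq in_set_conv_nth image_iff)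
  then show ?thesis by (simp add: children_def bij_betw_same_card)
qed

lemma tree_path_edge:
  assumes "grown A w T par" "tree_path par u cs ys" "set ys \<subseteq> T" "j < length cs"
  shows "g (cs ! j) ((u # ys) ! j) (ys ! j)"
proof -
  have "ys ! j \<in> T" using assms by (auto simp: tree_path_def)
  then have "ys ! j \<in> nbh {par (ys ! j)}" using assms(1) by (simp add: grown_def)
  then show ?thesis using assms(2,4) by (simp add: tree_path_def nbh_single)
qed

text \<open>A tree with one vertex per level is a path. Passing from \<open>children\<close> to
  \<open>path_deg\<close> lowers the demand of each new vertex by the edge to its parent as well,
  which is harmless because expansion is monotone in the demand.\<close>

lemma pendant_path:
  assumes ex: "expands A w"
    and w: "\<And>p. p \<in> slots \<Longrightarrow> w p \<le> int D"
    and off: "\<And>v i. v \<in> U - A \<Longrightarrow> i \<in> {1..t} \<Longrightarrow> w (v, i) = int D"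
    and A: "A \<subseteq> U" "u \<in> A"
    and cs: "set cs \<subseteq> {1..t}" "cs \<noteq> []" "1 \<le> w (u, hd cs)"
    and room: "card A + length cs + s + 2 * s * D \<le> card U"
  obtains ys where "length ys = length cs" "distinct ys" "set ys \<subseteq> U - A"
    "\<And>j. j < length cs \<Longrightarrow> g (cs ! j) ((u # ys) ! j) ((u # ys) ! Suc j)"
    "expands (A \<union> set ys) (\<lambda>(v, i). w (v, i) - int (path_deg (u # ys) cs v i))"
proof -
  obtain T par L where gr: "grown A w T par" and L: "card L = 1"
    and paths: "\<And>l. l \<in> L \<Longrightarrow> \<exists>ys. tree_path par u cs ys \<and> set ys \<subseteq> T \<and> last ys = l"
    by (rule grow_tree[OF ex w off A cs, where f = "\<lambda>_. 1"]) (use room D_ge in auto)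
  obtain l where "l \<in> L" using L by (auto simp: card_1_singleton_iff)
  then obtain ys where ys: "tree_path par u cs ys" "set ys \<subseteq> T" using paths by blast
  have gr': "grown A w (set ys) par" using gr ys(2) by (rule grown_rollback)
  have "expands (A \<union> set ys) (\<lambda>(v, i). w (v, i) - int (path_deg (u # ys) cs v i))"
  proof (rule expands_mono)
    show "expands (A \<union> set ys) (\<lambda>p. w p - children par (set ys) p)"
      using gr' by (simp add: grown_def)
    have "card {j. j < length cs \<and> cs ! j = i \<and> (u # ys) ! j = v} \<le> path_deg (u # ys) cs v i" for v i
      unfolding path_deg_def by (intro card_mono) auto
    then show "(case p of (v, i) \<Rightarrow> w (v, i) - int (path_deg (u # ys) cs v i))
        \<le> w p - children par (set ys) p" for p
      by (cases p) (simp add: children_tree_path[OF ys(1)])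
  qed
  moreover have "set ys \<subseteq> U - A" using gr' by (simp add: grown_def)
  ultimately show thesis
    using that[of ys] ys(1) tree_path_edge[OF gr ys] by (auto simp: tree_path_def)
qed

text \<open>Surplus length goes into an unbranched stem at \<open>a\<close>, where it costs one
  vertex per edge. Thus each tree has at most \<open>2 (D - 1) s\<close> vertices besides its stem,
  and the two stems together are shorter than the path.\<close>

lemma connecting_path:
  assumes ex: "expands A w"
    and w: "\<And>p. p \<in> slots \<Longrightarrow> w p \<le> int D"
    and off: "\<And>v i. v \<in> U - A \<Longrightarrow> i \<in> {1..t} \<Longrightarrow> w (v, i) = int D"
    and A: "A \<subseteq> U" "a \<in> A" "b \<in> A" "a \<noteq> b"
    and cs: "set cs \<subseteq> {1..t}" "2 * k + 3 \<le> length cs" "1 \<le> w (a, hd cs)" "1 \<le> w (b, last cs)"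
    and k: "s \<le> (D - 1) ^ k" "(D - 1) ^ k \<le> (D - 1) * s"
    and room: "card A + length cs + 4 * (D - 1) * s + s + 2 * s * D \<le> card U"
  obtains xs where "Suc (length xs) = length cs" "distinct xs" "set xs \<subseteq> U - A"
    "\<And>j. j < length cs \<Longrightarrow> g (cs ! j) ((a # xs @ [b]) ! j) ((a # xs @ [b]) ! Suc j)"
    "expands (A \<union> set xs) (\<lambda>(v, i). w (v, i) - int (path_deg (a # xs @ [b]) cs v i))"
proof -
  \<comment> \<open>The tree at \<open>a\<close> has a stem of \<open>q\<close> edges and
    \<open>k\<close> branching levels, the tree at \<open>b\<close> a stem of one edge and
    \<open>k\<close> branching levels, and one edge joins them:
    \<open>m = (q + k) + 1 + (1 + k)\<close>. The bound \<open>2 * k + 3\<close> makes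
    \<open>q\<close> positive.\<close>
  define m q where "m = length cs" and "q = length cs - 2 * k - 2"
  define n1 n2 where "n1 = q + k" and "n2 = 1 + k"
  define cs1 cs2 c where "cs1 = take n1 cs" and "cs2 = take n2 (rev cs)" and "c = cs ! n1"
  have m: "m = n1 + 1 + n2" and q: "1 \<le> q" and len: "length cs1 = n1" "length cs2 = n2"
    and ne: "cs1 \<noteq> []" "cs2 \<noteq> []"
    using cs(2) by (auto simp: m_def n1_def n2_def q_def cs1_def cs2_def)
  have csne: "cs \<noteq> []" using cs(2) by auto
  have hds: "hd cs1 = hd cs" "hd cs2 = last cs"
    using csne q by (auto simp: cs1_def cs2_def n1_def n2_def hd_rev)
  have sets: "set cs1 \<subseteq> {1..t}" "set cs2 \<subseteq> {1..t}"
    using cs(1) set_take_subset[of n1 cs] set_take_subset[of n2 "rev cs"]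
    unfolding cs1_def cs2_def set_rev by blast+
  have c: "c \<in> {1..t}"
    unfolding c_def using m by (intro subsetD[OF cs(1)] nth_mem) (simp add: m_def)
  have D2: "2 \<le> D - 1" using D_ge by simp
  have s1: "(\<Sum>j=1..n1. (D - 1) ^ (j - q)) \<le> q + 2 * ((D - 1) * s)"
    using sum_levels_le[OF D2, of q k] k(2) unfolding n1_def by linarith
  have s2: "(\<Sum>j=1..n2. (D - 1) ^ (j - 1)) \<le> 1 + 2 * ((D - 1) * s)"
    using sum_levels_le[OF D2, of 1 k] k(2) unfolding n2_def by linarith
  have qm: "q + 1 \<le> m" using cs(2) by (simp add: q_def m_def)
  have r1: "card A + (\<Sum>j=1..length cs1. (D - 1) ^ (j - q)) + s + 2 * s * D \<le> card U"
    using room s1 qm unfolding len m_def by linarith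
  obtain T1 par1 L1 where T1: "grown A w T1 par1"
    and cT1: "card T1 = (\<Sum>j=1..length cs1. (D - 1) ^ (j - q))"
    and L1: "card L1 = (D - 1) ^ (length cs1 - q)" "L1 \<subseteq> T1"
    and anc1: "\<And>y. y \<in> T1 \<Longrightarrow> fst (par1 y) \<in> insert a T1"
    and paths1: "\<And>l. l \<in> L1 \<Longrightarrow> \<exists>ys. tree_path par1 a cs1 ys \<and> set ys \<subseteq> T1 \<and> last ys = l"
  proof (rule grow_tree[OF ex w off A(1,2) sets(1) ne(1), where f = "\<lambda>j. (D - 1) ^ (j - q)"])
    show "(D - 1) ^ (Suc j - q) \<le> (D - 1) * (D - 1) ^ (j - q)" for j
      using D2 by (cases "q \<le> j") (auto simp: Suc_diff_le)
  qed (use cs(3) hds q r1 in auto)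
  have T1U: "T1 \<subseteq> U - A" using T1 by (simp add: grown_def)
  have finA: "finite A" and finT1: "finite T1"
    using A(1) T1U by (auto intro: finite_subset[OF _ finite_U])
  define w2 where "w2 = (\<lambda>p. w p - children par1 T1 p)"
  have ch0: "children par1 T1 (v, i) = 0" if "v \<notin> insert a T1" for v i
  proof -
    have "{y \<in> T1. par1 y = (v, i)} = {}" using anc1 that by fastforce
    then show ?thesis unfolding children_def by (simp only: card.empty of_nat_0)
  qed
  have cA2: "card (A \<union> T1) = card A + card T1"
    using finA finT1 T1U by (intro card_Un_disjoint) auto
  have r2: "card (A \<union> T1) + (\<Sum>j=1..length cs2. (D - 1) ^ (j - 1)) + s + 2 * s * D \<le> card U"
    using room s1 s2 qm unfolding len m_def cA2 cT1 by linarith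
  obtain T2 par2 L2 where T2: "grown (A \<union> T1) w2 T2 par2"
    and L2: "card L2 = (D - 1) ^ (length cs2 - 1)" "L2 \<subseteq> T2"
    and paths2: "\<And>l. l \<in> L2 \<Longrightarrow> \<exists>ys. tree_path par2 b cs2 ys \<and> set ys \<subseteq> T2 \<and> last ys = l"
  proof (rule grow_tree[where A = "A \<union> T1" and w = w2 and u = b and cs = cs2
        and f = "\<lambda>j. (D - 1) ^ (j - 1)"])
    show "expands (A \<union> T1) w2" using T1 by (simp add: grown_def w2_def)
    show "w2 p \<le> int D" if "p \<in> slots" for p using w[OF that] by (simp add: w2_def children_def)
    show "w2 (v, i) = int D" if "v \<in> U - (A \<union> T1)" "i \<in> {1..t}" for v i
      using that off[of v i] ch0[of v i] A(2) by (auto simp: w2_def)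
    \<comment> \<open>The first tree takes demand only from \<open>a\<close> and from its own
      vertices, so the demand at \<open>b\<close> is intact.\<close>
    have "b \<notin> insert a T1" using A T1U by auto
    then show "1 \<le> w2 (b, hd cs2)"
      using cs(4) ch0[of b "last cs"] by (simp add: w2_def hds)
    show "(D - 1) ^ (Suc j - 1) \<le> (D - 1) * (D - 1) ^ (j - 1)" if "1 \<le> j" for j
      using that by (cases j) auto
  qed (use A T1U sets(2) ne(2) r2 in auto)
  have T2U: "T2 \<subseteq> U - (A \<union> T1)" using T2 by (simp add: grown_def)
  have "s \<le> card (L1 \<times> {c})" "s \<le> card L2"
    using k(1) L1(1) L2(1) by (simp_all add: len n1_def n2_def card_cartesian_product)
  moreover have "L1 \<times> {c} \<subseteq> slots" "L2 \<subseteq> U" using L1(2) L2(2) T1U T2U c by auto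
  ultimately have "\<exists>(v, i)\<in>L1 \<times> {c}. \<exists>y\<in>L2. g i v y"
    using joined[unfolded s_joined_def, rule_format, of "L1 \<times> {c}" L2] by simp
  then obtain l1 l2 where l: "l1 \<in> L1" "l2 \<in> L2" "g c l1 l2" by auto
  obtain ys where ys: "tree_path par1 a cs1 ys" "set ys \<subseteq> T1" "last ys = l1"
    using paths1[OF l(1)] by blast
  obtain zs where zs: "tree_path par2 b cs2 zs" "set zs \<subseteq> T2" "last zs = l2"
    using paths2[OF l(2)] by blast
  have lys: "length ys = n1" "distinct ys" and lzs: "length zs = n2" "distinct zs"
    using ys zs by (auto simp: tree_path_def len)
  define xs where "xs = ys @ rev zs"
  define z where "z = a # xs @ [b]"
  have lz: "length z = Suc m" using lys lzs m by (simp add: z_def xs_def)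
  have z1: "z ! j = (a # ys) ! j" if "j \<le> n1" for j
  proof -
    have "z = (a # ys) @ rev zs @ [b]" by (simp add: z_def xs_def)
    then show ?thesis using that lys by (simp only: nth_append) simp
  qed
  \<comment> \<open>The second tree is read backwards: its vertex at depth \<open>j\<close> stands
    at position \<open>m - j\<close>, and its edge number \<open>j\<close> is edge
    \<open>m - Suc j\<close> of the path.\<close>
  have z2: "z ! (m - j) = (b # zs) ! j" if "j \<le> n2" for j
  proof -
    have "rev z = (b # zs) @ rev ys @ [a]" by (simp add: z_def xs_def)
    then have "rev z ! j = (b # zs) ! j" using that lzs by (simp only: nth_append) simp
    moreover have "rev z ! j = z ! (m - j)" using that lz m by (simp add: rev_nth)
    ultimately show ?thesis by simp
  qed
  have c1: "cs1 ! j = cs ! j" if "j < n1" for j using that by (simp add: cs1_def)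
  have c2: "cs2 ! j = cs ! (m - Suc j)" if "j < n2" for j
    using that m by (simp add: cs2_def rev_nth m_def)
  have edges: "g (cs ! j) (z ! j) (z ! Suc j)" if j: "j < length cs" for j
  proof -
    consider "j < n1" | "j = n1" | "n1 < j" by linarith
    then show ?thesis
    proof cases
      case 1
      then show ?thesis using tree_path_edge[OF T1 ys(1,2), of j] by (simp add: len z1 c1)
    next
      case 2
      have "z ! n1 = l1"
        using z1[of n1] ys(3) lys q by (cases ys rule: rev_cases) (auto simp: n1_def nth_append)
      moreover have "z ! Suc n1 = l2"
        using z2[of n2] zs(3) lzs m by (cases zs rule: rev_cases) (auto simp: n2_def nth_append)
      ultimately show ?thesis using 2 l(3) by (simp add: c_def)
    next
      case 3
      define i where "i = m - Suc j"
      have i: "i < n2" "m - i = Suc j" "m - Suc i = j" using 3 j m by (auto simp: i_def m_def)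
      have "g (cs ! j) (z ! Suc j) (z ! j)"
        using tree_path_edge[OF T2 zs(1,2), of i] z2[of i] z2[of "Suc i"] c2[of i] i
        by (simp add: len)
      then show ?thesis using edge_sym[of "cs ! j"] cs(1) nth_mem[OF j] by blast
    qed
  qed
  \<comment> \<open>A tree charges each edge to the end nearer its root, and neither charges the
    joining edge. The two index sets lie on different sides of position \<open>n1\<close>, so
    \<open>path_deg\<close> dominates their sum.\<close>
  have deg: "children par1 (set ys) (v, i) + children par2 (set zs) (v, i) \<le> int (path_deg z cs v i)"
    for v i
  proof -
    define J1 where "J1 = {j. j < n1 \<and> cs1 ! j = i \<and> (a # ys) ! j = v}"
    define J2 where "J2 = {j. j < n2 \<and> cs2 ! j = i \<and> (b # zs) ! j = v}"
    have "card ((\<lambda>j. m - Suc j) ` J2) = card J2"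
      using m by (intro card_image) (auto simp: J2_def inj_on_def)
    moreover have "J1 \<inter> (\<lambda>j. m - Suc j) ` J2 = {}"
      using m by (auto simp: J1_def J2_def)
    ultimately have "card J1 + card J2 = card (J1 \<union> (\<lambda>j. m - Suc j) ` J2)"
      by (subst card_Un_disjoint) (auto simp: J1_def J2_def)
    also have "\<dots> \<le> path_deg z cs v i"
      unfolding path_deg_def
    proof (intro card_mono)
      show "J1 \<union> (\<lambda>j. m - Suc j) ` J2 \<subseteq> {j. j < length cs \<and> cs ! j = i \<and> (v = z ! j \<or> v = z ! Suc j)}"
      proof
        fix x assume "x \<in> J1 \<union> (\<lambda>j. m - Suc j) ` J2"
        then consider "x \<in> J1" | j where "j \<in> J2" "x = m - Suc j" by auto
        then show "x \<in> {j. j < length cs \<and> cs ! j = i \<and> (v = z ! j \<or> v = z ! Suc j)}"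
        proof cases
          case 1
          then show ?thesis using m by (auto simp: J1_def z1 c1 m_def)
        next
          case 2
          then have "Suc x = m - j" "j < n2" using m by (auto simp: J2_def)
          then show ?thesis using 2 m z2[of j] c2[of j] by (auto simp: J2_def m_def)
        qed
      qed
    qed simp
    finally show ?thesis
      using children_tree_path[OF ys(1)] children_tree_path[OF zs(1)]
      by (simp add: J1_def J2_def len)
  qed
  \<comment> \<open>The trees are pruned in reverse order. Once the second has shrunk to
    \<open>zs\<close>, the first can be regarded as grown from \<open>A \<union> set zs\<close>,
    because \<open>grown\<close> depends only on the total occupied set and the total residual
    demand; then it is pruned to \<open>ys\<close>.\<close>
  have "grown (A \<union> T1) w2 (set zs) par2" using T2 zs(2) by (rule grown_rollback)
  then have "expands (A \<union> T1 \<union> set zs) (\<lambda>p. w2 p - children par2 (set zs) p)"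
    by (simp add: grown_def)
  moreover have "A \<union> T1 \<union> set zs = A \<union> set zs \<union> T1" by auto
  ultimately have "grown (A \<union> set zs) (\<lambda>p. w p - children par2 (set zs) p) T1 par1"
    using T1 zs(2) T2U by (auto simp: grown_def w2_def algebra_simps)
  then have "grown (A \<union> set zs) (\<lambda>p. w p - children par2 (set zs) p) (set ys) par1"
    using ys(2) by (rule grown_rollback)
  moreover have "A \<union> set zs \<union> set ys = A \<union> set xs" by (auto simp: xs_def)
  ultimately have "expands (A \<union> set xs) (\<lambda>p. w p - children par2 (set zs) p - children par1 (set ys) p)"
    by (simp add: grown_def)
  then have "expands (A \<union> set xs) (\<lambda>(v, i). w (v, i) - int (path_deg z cs v i))"
    by (rule expands_mono) (use deg in \<open>auto simp: algebra_simps\<close>)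
  moreover have "distinct xs" "set xs \<subseteq> U - A"
    using lys lzs ys(2) zs(2) T1U T2U by (auto simp: xs_def)
  moreover have "Suc (length xs) = length cs" using lys lzs m by (simp add: xs_def m_def)
  ultimately show thesis using that[of xs] edges by (simp add: z_def)
qed

end

section \<open>Edges of a path and coloured degrees\<close>

lemma inj_on_path_edge:
  assumes "distinct p"
  shows "inj_on (\<lambda>j. {p ! j, p ! Suc j}) {j. Suc j < length p}"
  using assms by (auto simp: inj_on_def doubleton_eq_iff nth_eq_iff_index_eq)

lemma finite_path_edges [simp]: "finite (path_edges p)"
proof -
  have "path_edges p = (\<lambda>j. {p ! j, p ! Suc j}) ` {j. Suc j < length p}"
    by (auto simp: path_edges_def)
  moreover have "finite {j. Suc j < length p}"
    by (rule finite_subset[of _ "{..<length p}"]) auto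
  ultimately show ?thesis by simp
qed

lemma path_edges_subset: "e \<in> path_edges p \<Longrightarrow> e \<subseteq> set p"
  by (auto simp: path_edges_def)

lemma path_edges_rev: "path_edges (rev p) = path_edges p"
proof -
  have sub: "path_edges (rev q) \<subseteq> path_edges q" for q :: "'a list"
  proof
    fix e assume "e \<in> path_edges (rev q)"
    then obtain j where j: "Suc j < length q" "e = {rev q ! j, rev q ! Suc j}"
      by (auto simp: path_edges_def)
    define i where "i = length q - Suc (Suc j)"
    have "rev q ! j = q ! Suc i" "rev q ! Suc j = q ! i" "Suc i < length q"
      using j(1) by (auto simp: rev_nth i_def Suc_diff_Suc)
    then show "e \<in> path_edges q" using j(2) by (auto simp: path_edges_def insert_commute)
  qed
  show ?thesis using sub[of p] sub[of "rev p"] by auto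
qed

lemma internal_nth:
  assumes "0 < j" "Suc j < length p"
  shows "p ! j \<in> set (butlast (tl p))"
proof -
  have "butlast (tl p) ! (j - 1) = p ! j" "j - 1 < length (butlast (tl p))"
    using assms by (auto simp: nth_butlast nth_tl)
  then show ?thesis by (metis nth_mem)
qed

text \<open>With at least two edges, none joins the two ends directly. The internal vertices of an
  added path are new, so this shows that all its edges are new.\<close>

lemma path_edge_meets_internal:
  assumes "3 \<le> length p" "e \<in> path_edges p"
  shows "e \<inter> set (butlast (tl p)) \<noteq> {}"
proof -
  obtain j where j: "Suc j < length p" "e = {p ! j, p ! Suc j}"
    using assms(2) by (auto simp: path_edges_def)
  show ?thesis
  proof (cases "j = 0")
    case True
    then show ?thesis using internal_nth[of 1 p] assms(1) j by auto
  next
    case False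
    then show ?thesis using internal_nth[of j p] j by auto
  qed
qed

lemma deg_col_mono:
  assumes "E \<subseteq> E'" "finite E'"
  shows "deg_col E col i h \<le> deg_col E' col i h"
  unfolding deg_col_def using assms by (intro card_mono) auto

text \<open>Distinctness makes positions and edges correspond bijectively, which turns degrees in
  the coloured graph into the demands consumed along the path.\<close>

lemma deg_col_add_path:
  assumes "distinct p" "finite E" "path_edges p \<inter> E = {}"
  shows "deg_col (E \<union> path_edges p) col i h = deg_col E col i h
    + path_deg p (map (\<lambda>j. col {p ! j, p ! Suc j}) [0..<length p - 1]) h i"
proof -
  let ?cs = "map (\<lambda>j. col {p ! j, p ! Suc j}) [0..<length p - 1]"
  have un: "{e \<in> E \<union> path_edges p. h \<in> e \<and> col e = i}
      = {e \<in> E. h \<in> e \<and> col e = i} \<union> {e \<in> path_edges p. h \<in> e \<and> col e = i}" by auto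
  have "deg_col (E \<union> path_edges p) col i h
      = deg_col E col i h + card {e \<in> path_edges p. h \<in> e \<and> col e = i}"
    unfolding deg_col_def un using assms(2,3) by (intro card_Un_disjoint) auto
  moreover have "bij_betw (\<lambda>j. {p ! j, p ! Suc j})
      {j. j < length ?cs \<and> ?cs ! j = i \<and> (h = p ! j \<or> h = p ! Suc j)}
      {e \<in> path_edges p. h \<in> e \<and> col e = i}"
    unfolding bij_betw_def
  proof
    show "inj_on (\<lambda>j. {p ! j, p ! Suc j})
        {j. j < length ?cs \<and> ?cs ! j = i \<and> (h = p ! j \<or> h = p ! Suc j)}"
      by (rule inj_on_subset[OF inj_on_path_edge[OF assms(1)]]) auto
    show "(\<lambda>j. {p ! j, p ! Suc j}) ` {j. j < length ?cs \<and> ?cs ! j = i \<and> (h = p ! j \<or> h = p ! Suc j)}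
        = {e \<in> path_edges p. h \<in> e \<and> col e = i}"
      by (force simp: path_edges_def)
  qed
  ultimately show ?thesis by (simp add: path_deg_def bij_betw_same_card)
qed

lemma path_deg_pos:
  assumes "j < length cs" "cs ! j = i" "v = z ! j \<or> v = z ! Suc j"
  shows "1 \<le> path_deg z cs v i"
proof -
  have "j \<in> {j. j < length cs \<and> cs ! j = i \<and> (v = z ! j \<or> v = z ! Suc j)}"
    using assms by auto
  then have "0 < path_deg z cs v i"
    unfolding path_deg_def by (subst card_gt_0_iff) auto
  then show ?thesis by simp
qed

section \<open>Adding one path to a partial embedding\<close>

context joined_family
begin

text \<open>Degrees refer to the part embedded so far. With all of \<open>VC\<close> as roots,
  \<open>P\<close> is empty, and the last clause is the nonnegativity of \<open>R\<close> for sets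
  of at most \<open>2s\<close> slots.\<close>

definition host_emb :: "'h set \<Rightarrow> 'h set set \<Rightarrow> ('h set \<Rightarrow> nat) \<Rightarrow> ('h \<Rightarrow> 'v) \<Rightarrow> bool" where
  "host_emb VC EC col \<phi> \<longleftrightarrow> finite VC \<and> finite EC \<and> (\<forall>e\<in>EC. e \<subseteq> VC)
     \<and> embedding VC EC col U g \<phi>
     \<and> expands (\<phi> ` VC) (\<lambda>(v, i). int D - int (deg_img VC EC col \<phi> v i))"

text \<open>A single leaf edge, a pendant path and a path between two embedded vertices are treated
  alike; \<open>long\<close> is demanded only in the last of these.\<close>

lemma host_emb_add_path:
  assumes st: "host_emb VC EC col \<phi>"
    and p: "distinct p" "2 \<le> length p" "hd p \<in> VC" "set (butlast (tl p)) \<inter> VC = {}"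
      "path_edges p \<inter> EC = {}" "\<And>e. e \<in> path_edges p \<Longrightarrow> col e \<in> {1..t}"
    and deg: "\<And>h i. h \<in> VC \<Longrightarrow> i \<in> {1..t} \<Longrightarrow> deg_col (EC \<union> path_edges p) col i h \<le> D"
    and long: "last p \<in> VC \<Longrightarrow> 2 * k + 4 \<le> length p"
    and k: "s \<le> (D - 1) ^ k" "(D - 1) ^ k \<le> (D - 1) * s"
    and room: "card (VC \<union> set p) + 4 * (D - 1) * s + 2 * s + 2 * s * D \<le> card U"
  shows "\<exists>\<phi>'. host_emb (VC \<union> set p) (EC \<union> path_edges p) col \<phi>' \<and> (\<forall>x\<in>VC. \<phi>' x = \<phi> x)"
proof -
  define m where "m = length p - 1"
  define cs where "cs = map (\<lambda>j. col {p ! j, p ! Suc j}) [0..<m]"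
  define A where "A = \<phi> ` VC"
  define w where "w = (\<lambda>(v, i). int D - int (deg_img VC EC col \<phi> v i))"
  have lp: "length p = Suc m" "1 \<le> m" using p(2) by (auto simp: m_def)
  have lcs: "length cs = m" by (simp add: cs_def)
  have pne: "p \<noteq> []" using lp by auto
  have hdp: "hd p = p ! 0" and lastp: "last p = p ! m"
    using pne lp by (auto simp: hd_conv_nth last_conv_nth)
  have finVC: "finite VC" and finEC: "finite EC" and ECV: "\<And>e. e \<in> EC \<Longrightarrow> e \<subseteq> VC"
    and inj: "inj_on \<phi> VC" and AU: "A \<subseteq> U"
    and edg: "\<And>e x y. e \<in> EC \<Longrightarrow> e = {x, y} \<Longrightarrow> g (col e) (\<phi> x) (\<phi> y)"
    and ex: "expands A w"
    using st by (auto simp: host_emb_def embedding_def A_def w_def)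
  have cA: "card A = card VC" unfolding A_def by (rule card_image[OF inj])
  have pe: "{p ! j, p ! Suc j} \<in> path_edges p" if "j < m" for j
    using that lp by (auto simp: path_edges_def)
  have csj: "cs ! j \<in> {1..t}" if "j < m" for j
    using that p(6)[OF pe[OF that]] by (simp add: cs_def)
  then have cst: "set cs \<subseteq> {1..t}"
    using lcs by (metis in_set_conv_nth subsetI)
  have wD: "w q \<le> int D" for q by (auto simp: w_def split: prod.splits)
  have off: "w (v, i) = int D" if "v \<in> U - A" for v i
    using that by (simp add: w_def deg_img_def A_def)
  have degE: "deg_col (EC \<union> path_edges p) col i h = deg_col EC col i h + path_deg p cs h i" for i h
    using deg_col_add_path[OF p(1) finEC p(5)] by (simp add: cs_def m_def)
  \<comment> \<open>The degree bound \<open>D\<close> holds for the extended graph, which already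
    counts the edge about to be embedded; hence one unit of demand in its colour is still
    free.\<close>
  have wpos: "1 \<le> w (\<phi> h, cs ! j)" if "h \<in> VC" "j < m" "h = p ! j \<or> h = p ! Suc j" for h j
  proof -
    have "1 \<le> path_deg p cs h (cs ! j)" using that lcs by (intro path_deg_pos[of j]) auto
    moreover have "deg_col (EC \<union> path_edges p) col (cs ! j) h \<le> D"
      using deg that csj by blast
    ultimately have "deg_col EC col (cs ! j) h + 1 \<le> D" unfolding degE by linarith
    then show ?thesis using that inj by (simp add: w_def deg_img_def)
  qed
  have int: "p ! j \<notin> VC" if "0 < j" "j < m" for j
    using internal_nth[of j p] that lp p(4) by auto
  have csne: "cs \<noteq> []" using lcs lp by auto
  have hdcs: "hd cs = cs ! 0" and lastcs: "last cs = cs ! (m - 1)"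
    using csne lcs by (auto simp: hd_conv_nth last_conv_nth)
  \<comment> \<open>\<open>z\<close> lists the images along \<open>p\<close>. This description is
    common to both cases, so the new map is built only once.\<close>
  have "\<exists>z. length z = Suc m \<and> distinct z \<and> (\<forall>j\<le>m. p ! j \<in> VC \<longrightarrow> z ! j = \<phi> (p ! j))
      \<and> (\<forall>j\<le>m. p ! j \<notin> VC \<longrightarrow> z ! j \<in> U - A)
      \<and> (\<forall>j<m. g (cs ! j) (z ! j) (z ! Suc j))
      \<and> expands (A \<union> set z) (\<lambda>(v, i). w (v, i) - int (path_deg z cs v i))"
  proof (cases "last p \<in> VC")
    case True
    have "p ! 0 \<noteq> p ! m" using p(1) lp by (simp add: nth_eq_iff_index_eq)
    then have ne: "\<phi> (hd p) \<noteq> \<phi> (last p)"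
      using inj p(3) True by (metis hdp lastp inj_onD)
    have "set p = insert (p ! 0) (insert (p ! m) ((\<lambda>j. p ! j) ` {1..<m}))"
    proof -
      have "set p = (\<lambda>j. p ! j) ` {..<Suc m}" using lp by (auto simp: set_conv_nth)
      moreover have "{..<Suc m} = insert 0 (insert m {1..<m})" by auto
      ultimately show ?thesis by simp
    qed
    then have "VC \<union> set p = VC \<union> (\<lambda>j. p ! j) ` {1..<m}"
      using True p(3) by (auto simp: hdp lastp)
    moreover have "card ((\<lambda>j. p ! j) ` {1..<m}) = m - 1"
      using p(1) lp by (subst card_image) (auto simp: inj_on_def nth_eq_iff_index_eq)
    moreover have "VC \<inter> (\<lambda>j. p ! j) ` {1..<m} = {}" using int by auto
    ultimately have "card (VC \<union> set p) = card VC + (m - 1)"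
      using finVC by (simp add: card_Un_disjoint)
    \<comment> \<open>The path has \<open>m\<close> edges but only \<open>m - 1\<close> new
      vertices; the missing unit is taken from one of the two summands \<open>s\<close> in
      \<open>room\<close>.\<close>
    then have rm: "card A + length cs + 4 * (D - 1) * s + s + 2 * s * D \<le> card U"
      using room s_pos lp lcs cA by linarith
    have lng: "2 * k + 3 \<le> length cs" using long[OF True] lp lcs by simp
    have w1: "1 \<le> w (\<phi> (hd p), hd cs)" "1 \<le> w (\<phi> (last p), last cs)"
      using wpos[of "hd p" 0] wpos[of "last p" "m - 1"] p(3) True lp
      by (auto simp: hdp lastp hdcs lastcs)
    obtain xs where xs: "Suc (length xs) = length cs" "distinct xs" "set xs \<subseteq> U - A"
      "\<And>j. j < length cs \<Longrightarrow> g (cs ! j) ((\<phi> (hd p) # xs @ [\<phi> (last p)]) ! j)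
          ((\<phi> (hd p) # xs @ [\<phi> (last p)]) ! Suc j)"
      "expands (A \<union> set xs)
        (\<lambda>(v, i). w (v, i) - int (path_deg (\<phi> (hd p) # xs @ [\<phi> (last p)]) cs v i))"
      by (rule connecting_path[OF ex wD off AU _ _ ne cst lng w1 k rm]) (use p(3) True in \<open>auto simp: A_def\<close>)
    define z where "z = \<phi> (hd p) # xs @ [\<phi> (last p)]"
    have z0: "z ! 0 = \<phi> (hd p)" by (simp add: z_def)
    have zm: "z ! m = \<phi> (last p)" using xs(1) lcs by (auto simp: z_def nth_append nth_Cons split: nat.splits)
    have zj: "z ! j \<in> U - A" if "0 < j" "j < m" for j
    proof -
      have "z ! j = xs ! (j - 1)" "j - 1 < length xs"
        using that xs(1) lcs by (auto simp: z_def nth_append nth_Cons split: nat.splits)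
      then show ?thesis using xs(3) by (metis nth_mem subsetD)
    qed
    have "distinct z" using xs(2,3) ne p(3) True by (auto simp: z_def A_def)
    moreover have "A \<union> set z = A \<union> set xs" using p(3) True by (auto simp: z_def A_def)
    moreover have "length z = Suc m" using xs(1) lcs by (simp add: z_def)
    moreover have "z ! j = \<phi> (p ! j)" if "j \<le> m" "p ! j \<in> VC" for j
      using that int[of j] z0 zm hdp lastp by (metis le_neq_implies_less not_gr_zero)
    moreover have "z ! j \<in> U - A" if "j \<le> m" "p ! j \<notin> VC" for j
      using that zj[of j] p(3) True hdp lastp by (metis le_neq_implies_less not_gr_zero)
    ultimately show ?thesis using xs(4,5) lcs unfolding z_def by (intro exI[of _ z]) (auto simp: z_def)
  next
    case False
    have nV: "p ! j \<notin> VC" if "0 < j" "j \<le> m" for j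
      using that int[of j] False lastp by (cases "j = m") auto
    have "set p = insert (p ! 0) ((\<lambda>j. p ! j) ` {1..m})"
    proof -
      have "set p = (\<lambda>j. p ! j) ` {..<Suc m}" using lp by (auto simp: set_conv_nth)
      moreover have "{..<Suc m} = insert 0 {1..m}" by auto
      ultimately show ?thesis by simp
    qed
    then have "VC \<union> set p = VC \<union> (\<lambda>j. p ! j) ` {1..m}"
      using p(3) by (auto simp: hdp)
    moreover have "card ((\<lambda>j. p ! j) ` {1..m}) = m"
      using p(1) lp by (subst card_image) (auto simp: inj_on_def nth_eq_iff_index_eq)
    moreover have "VC \<inter> (\<lambda>j. p ! j) ` {1..m} = {}" using nV by auto
    ultimately have "card (VC \<union> set p) = card VC + m"
      using finVC by (simp add: card_Un_disjoint)
    then have rm: "card A + length cs + s + 2 * s * D \<le> card U"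
      using room lcs cA by linarith
    have w1: "1 \<le> w (\<phi> (hd p), hd cs)"
      using wpos[of "hd p" 0] p(3) lp by (auto simp: hdp hdcs)
    obtain ys where ys: "length ys = length cs" "distinct ys" "set ys \<subseteq> U - A"
      "\<And>j. j < length cs \<Longrightarrow> g (cs ! j) ((\<phi> (hd p) # ys) ! j) ((\<phi> (hd p) # ys) ! Suc j)"
      "expands (A \<union> set ys) (\<lambda>(v, i). w (v, i) - int (path_deg (\<phi> (hd p) # ys) cs v i))"
      by (rule pendant_path[OF ex wD off AU _ cst csne w1 rm]) (use p(3) in \<open>auto simp: A_def\<close>)
    define z where "z = \<phi> (hd p) # ys"
    have "distinct z" using ys(2,3) p(3) by (auto simp: z_def A_def)
    moreover have "A \<union> set z = A \<union> set ys" using p(3) by (auto simp: z_def A_def)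
    moreover have "length z = Suc m" using ys(1) lcs by (simp add: z_def)
    moreover have "z ! j = \<phi> (p ! j)" if "j \<le> m" "p ! j \<in> VC" for j
      using that nV[of j] by (cases j) (auto simp: z_def hdp)
    moreover have "z ! j \<in> U - A" if "j \<le> m" "p ! j \<notin> VC" for j
    proof -
      have "0 < j" using that p(3) hdp by (cases j) auto
      then have "z ! j \<in> set ys" using that ys(1) lcs by (cases j) (auto simp: z_def)
      then show ?thesis using ys(3) by auto
    qed
    ultimately show ?thesis using ys(4,5) lcs unfolding z_def by (intro exI[of _ z]) (auto simp: z_def)
  qed
  then obtain z where z: "length z = Suc m" "distinct z"
    and zV: "\<And>j. j \<le> m \<Longrightarrow> p ! j \<in> VC \<Longrightarrow> z ! j = \<phi> (p ! j)"
    and zN: "\<And>j. j \<le> m \<Longrightarrow> p ! j \<notin> VC \<Longrightarrow> z ! j \<in> U - A"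
    and zE: "\<And>j. j < m \<Longrightarrow> g (cs ! j) (z ! j) (z ! Suc j)"
    and zex: "expands (A \<union> set z) (\<lambda>(v, i). w (v, i) - int (path_deg z cs v i))"
    by blast
  \<comment> \<open>Where \<open>p\<close> meets \<open>VC\<close> the old value is kept, which
    \<open>z\<close> repeats; outside \<open>VC\<close> and \<open>p\<close> the value is
    irrelevant.\<close>
  define \<psi> where "\<psi> x = (if x \<in> VC then \<phi> x else the (map_of (zip p z) x))" for x
  define VC' where "VC' = VC \<union> set p"
  define EC' where "EC' = EC \<union> path_edges p"
  have \<psi>p: "\<psi> (p ! j) = z ! j" if "j \<le> m" for j
    using that zV[OF that] map_of_zip_nth[of p z j] p(1) lp z(1) by (simp add: \<psi>_def)
  have \<psi>V: "\<psi> x = \<phi> x" if "x \<in> VC" for x using that by (simp add: \<psi>_def)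
  have inp: "\<exists>j\<le>m. x = p ! j" if "x \<in> set p" for x
    using that lp by (metis in_set_conv_nth less_Suc_eq_le)
  have \<psi>N: "\<psi> x \<in> U - A" if x: "x \<in> VC' - VC" for x
  proof -
    obtain j where "j \<le> m" "x = p ! j" using inp[of x] x by (auto simp: VC'_def)
    then show ?thesis using zN \<psi>p x by auto
  qed
  have inj': "inj_on \<psi> VC'"
  proof (rule inj_onI)
    fix x y assume xy: "x \<in> VC'" "y \<in> VC'" "\<psi> x = \<psi> y"
    show "x = y"
    proof (cases "x \<in> VC \<or> y \<in> VC")
      case True
      have "x \<in> VC \<longleftrightarrow> y \<in> VC"
        using xy \<psi>V \<psi>N unfolding A_def by (metis Diff_iff imageI)
      then show ?thesis using True xy \<psi>V inj by (metis inj_onD)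
    next
      case False
      then obtain i j where "i \<le> m" "x = p ! i" "j \<le> m" "y = p ! j"
        using inp xy unfolding VC'_def by (metis UnE)
      then show ?thesis using xy(3) \<psi>p z by (auto simp: nth_eq_iff_index_eq)
    qed
  qed
  have setz: "set z = \<psi> ` set p"
  proof -
    have "set z = (\<lambda>j. z ! j) ` {..m}" using z(1) by (auto simp: set_conv_nth less_Suc_eq_le)
    also have "\<dots> = (\<lambda>j. \<psi> (p ! j)) ` {..m}" using \<psi>p by auto
    also have "\<dots> = \<psi> ` ((\<lambda>j. p ! j) ` {..m})" by (simp add: image_image)
    also have "(\<lambda>j. p ! j) ` {..m} = set p" using lp by (auto simp: set_conv_nth less_Suc_eq_le)
    finally show ?thesis .
  qed
  have img: "\<psi> ` VC' = A \<union> set z"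
    using \<psi>V by (auto simp: VC'_def A_def setz image_Un)
  have degz: "path_deg z cs (\<psi> h) i = path_deg p cs h i" if h: "h \<in> VC'" for h i
  proof -
    have eq: "\<psi> h = z ! j \<longleftrightarrow> h = p ! j" if "j \<le> m" for j
    proof -
      have "p ! j \<in> VC'" using that lp by (simp add: VC'_def)
      then show ?thesis using \<psi>p[OF that] inj' h by (metis inj_onD)
    qed
    have "(j < m \<and> cs ! j = i \<and> (\<psi> h = z ! j \<or> \<psi> h = z ! Suc j))
        \<longleftrightarrow> (j < m \<and> cs ! j = i \<and> (h = p ! j \<or> h = p ! Suc j))" for j
      using eq[of j] eq[of "Suc j"] by auto
    then show ?thesis unfolding path_deg_def lcs by (simp only:)
  qed
  have "expands (\<psi> ` VC') (\<lambda>(v, i). int D - int (deg_img VC' EC' col \<psi> v i))"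
    unfolding img
  proof (rule expands_mono[OF zex], clarify)
    fix v i assume "v \<in> U"
    have "deg_img VC EC col \<phi> v i + path_deg z cs v i \<le> deg_img VC' EC' col \<psi> v i"
    proof (cases "v \<in> \<psi> ` VC'")
      case True
      then obtain h where h: "h \<in> VC'" "v = \<psi> h" by auto
      \<comment> \<open>For a new \<open>h\<close> the default 0 of \<open>deg_img\<close> is the
        right value, since no earlier edge contains \<open>h\<close>.\<close>
      have "deg_img VC EC col \<phi> v i = deg_col EC col i h"
      proof (cases "h \<in> VC")
        case True
        then show ?thesis using h inj \<psi>V by (simp add: deg_img_def)
      next
        case False
        then have "v \<notin> \<phi> ` VC" using \<psi>N[of h] h by (simp add: A_def)
        moreover have "{e \<in> EC. h \<in> e \<and> col e = i} = {}" using False ECV by auto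
        ultimately show ?thesis unfolding deg_img_def deg_col_def by (simp only: card.empty if_False)
      qed
      moreover have "deg_img VC' EC' col \<psi> v i = deg_col EC' col i h"
        using h inj' by (simp add: deg_img_def)
      ultimately show ?thesis using degE degz[OF h(1)] h(2) by (simp add: EC'_def)
    next
      case False
      then have "v \<notin> A" "v \<notin> set z" unfolding img by auto
      moreover from this have "{j. j < length cs \<and> cs ! j = i \<and> (v = z ! j \<or> v = z ! Suc j)} = {}"
        using z(1) lcs by auto
      then have "path_deg z cs v i = 0" unfolding path_deg_def by (simp only: card.empty)
      ultimately show ?thesis by (simp add: deg_img_def A_def)
    qed
    then show "int D - int (deg_img VC' EC' col \<psi> v i) \<le> w (v, i) - int (path_deg z cs v i)"
      by (simp add: w_def)
  qed
  moreover have "\<psi> ` VC' \<subseteq> U" using \<psi>V \<psi>N AU unfolding A_def by blast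
  moreover have "g (col e) (\<psi> x) (\<psi> y)" if e: "e \<in> EC'" "e = {x, y}" for e x y
  proof (cases "e \<in> EC")
    case True
    then have "x \<in> VC" "y \<in> VC" using ECV e(2) by auto
    then show ?thesis using edg[OF True e(2)] \<psi>V by simp
  next
    case False
    then have ep: "e \<in> path_edges p" using e(1) by (simp add: EC'_def)
    then obtain j where j: "j < m" "e = {p ! j, p ! Suc j}" using lp by (auto simp: path_edges_def)
    have ce: "col e = cs ! j" using j by (simp add: cs_def)
    have 1: "g (col e) (\<psi> (p ! j)) (\<psi> (p ! Suc j))"
      using zE[OF j(1)] j(1) \<psi>p ce by simp
    have 2: "g (col e) (\<psi> (p ! Suc j)) (\<psi> (p ! j))"
      by (rule edge_sym[OF p(6)[OF ep] 1])
    show ?thesis using 1 2 j(2) e(2) unfolding ce by (auto simp: doubleton_eq_iff)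
  qed
  moreover have "finite VC'" "finite EC'" using finVC finEC by (auto simp: VC'_def EC'_def)
  moreover have "\<forall>e\<in>EC'. e \<subseteq> VC'" using ECV path_edges_subset by (fastforce simp: VC'_def EC'_def)
  ultimately have "host_emb VC' EC' col \<psi>"
    using inj' by (auto simp: host_emb_def embedding_def)
  then show ?thesis using \<psi>V by (auto simp: VC'_def EC'_def)
qed

end

section \<open>Walks, components and acyclicity\<close>

lemma UN_set_conv_nth: "(\<Union>x\<in>set xs. F x) = (\<Union>i<length xs. F (xs ! i))"
  by (force simp: in_set_conv_nth)

lemma walk_in_iff_successively:
  "walk_in E xs \<longleftrightarrow> xs \<noteq> [] \<and> successively (\<lambda>a b. {a, b} \<in> E) xs"
  by (auto simp: walk_in_def successively_conv_nth)

lemma comp_refl: "x \<in> S \<Longrightarrow> x \<in> comp S E x"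
  unfolding comp_def by (intro CollectI exI[of _ "[x]"]) (simp add: walk_in_def)

lemma comp_sym: "y \<in> comp S E x \<Longrightarrow> x \<in> comp S E y"
proof -
  assume "y \<in> comp S E x"
  then obtain xs where "walk_in E xs" "set xs \<subseteq> S" "hd xs = x" "last xs = y"
    by (auto simp: comp_def)
  then show ?thesis unfolding comp_def
    by (intro CollectI exI[of _ "rev xs"])
      (auto simp: walk_in_iff_successively insert_commute hd_rev last_rev)
qed

lemma comp_trans: "y \<in> comp S E x \<Longrightarrow> z \<in> comp S E y \<Longrightarrow> z \<in> comp S E x"
proof -
  assume "y \<in> comp S E x" "z \<in> comp S E y"
  then obtain xs ys where xs: "walk_in E xs" "set xs \<subseteq> S" "hd xs = x" "last xs = y"
    and ys: "walk_in E ys" "set ys \<subseteq> S" "hd ys = y" "last ys = z"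
    by (auto simp: comp_def)
  show ?thesis
  proof (cases "tl ys")
    case Nil
    then have "z = y" using ys by (cases ys) (auto simp: walk_in_def)
    then show ?thesis using \<open>y \<in> comp S E x\<close> by simp
  next
    case (Cons a as)
    then have "ys = y # a # as" using ys(3) by (cases ys) auto
    then show ?thesis unfolding comp_def using xs ys
      by (intro CollectI exI[of _ "xs @ a # as"])
        (auto simp: walk_in_iff_successively successively_append_iff)
  qed
qed

lemma comp_mono: "y \<in> comp S E x \<Longrightarrow> S \<subseteq> S' \<Longrightarrow> y \<in> comp S' E x"
  unfolding comp_def by blast

lemma comp_edge: "{x, y} \<in> E \<Longrightarrow> x \<in> S \<Longrightarrow> y \<in> S \<Longrightarrow> y \<in> comp S E x"
  unfolding comp_def by (intro CollectI exI[of _ "[x, y]"]) (auto simp: walk_in_def)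

text \<open>A shortest walk is a path: cutting out the stretch between two visits to a vertex would
  shorten it.\<close>

lemma comp_path:
  assumes "y \<in> comp S E x"
  obtains xs where "path_in E xs" "set xs \<subseteq> S" "hd xs = x" "last xs = y"
proof -
  define P where "P xs \<longleftrightarrow> walk_in E xs \<and> set xs \<subseteq> S \<and> hd xs = x \<and> last xs = y" for xs
  obtain xs0 where "P xs0" using assms by (auto simp: comp_def P_def)
  then obtain xs where xs: "P xs" and least: "\<And>ys. P ys \<Longrightarrow> length xs \<le> length ys"
    using ex_has_least_nat[of P xs0 length] by blast
  have "distinct xs"
  proof (rule ccontr)
    assume "\<not> distinct xs"
    then obtain as bs cs v where eq: "xs = as @ [v] @ bs @ [v] @ cs"
      using not_distinct_decomp by blast
    have "P (as @ [v] @ cs)"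
      using xs unfolding P_def eq
      by (cases as; cases cs) (auto simp: walk_in_iff_successively successively_append_iff successively_Cons hd_append
          split: if_splits)
    then show False using least eq by fastforce
  qed
  then show thesis using that xs by (auto simp: P_def path_in_def)
qed

text \<open>A path in \<open>S\<close> between two neighbours of \<open>y\<close> would close to a
  cycle through \<open>y\<close>. Thus a vertex outside \<open>S\<close> sends at most one edge into
  a component of \<open>S\<close>.\<close>

lemma acyclic_unique_edge:
  assumes ac: "acyclic_on V E" and S: "S \<subseteq> V" "y \<in> V" "y \<notin> S"
    and u: "{u, y} \<in> E" "{u', y} \<in> E" "u' \<in> comp S E u"
  shows "u = u'"
proof (rule ccontr)
  assume ne: "u \<noteq> u'"
  obtain xs where xs: "path_in E xs" "set xs \<subseteq> S" "hd xs = u" "last xs = u'"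
    using comp_path[OF u(3)] .
  have xne: "xs \<noteq> []" using xs(1) by (simp add: path_in_def walk_in_def)
  then have "2 \<le> length xs" using xs(3,4) ne by (cases xs; cases "tl xs") auto
  then have "cycle_on V E (xs @ [y])"
    using xs xne u S
    by (auto simp: cycle_on_def path_in_def walk_in_iff_successively successively_append_iff insert_commute)
  then show False using ac by (auto simp: acyclic_on_def)
qed

section \<open>Embedding the forest, then the paths\<close>

context joined_family
begin

text \<open>A maximal embedded induced part \<open>S\<close> is enlarged by a vertex
  \<open>y\<close> adjacent to it. Two neighbours of \<open>y\<close> in \<open>S\<close> would be
  linked inside \<open>S\<close> to roots in the component of \<open>y\<close>; that root is unique,
  so both would lie in one component of \<open>S\<close>, against acyclicity. Hence one leaf edge is
  all that is added.\<close>

lemma embed_forest: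
  assumes sg: "simple_graph V0 E0" and ac: "acyclic_on V0 E0"
    and Rt: "Rt \<subseteq> V0" "\<And>x. x \<in> V0 \<Longrightarrow> \<exists>!\<rho>. \<rho> \<in> Rt \<and> \<rho> \<in> comp V0 E0 x"
    and I: "finite I" "I \<inter> V0 = {}"
    and col: "\<And>e. e \<in> E0 \<Longrightarrow> col e \<in> {1..t}"
    and deg: "\<And>h i. h \<in> V0 \<union> I \<Longrightarrow> i \<in> {1..t} \<Longrightarrow> deg_col E0 col i h \<le> D"
    and k: "s \<le> (D - 1) ^ k" "(D - 1) ^ k \<le> (D - 1) * s"
    and room: "card (V0 \<union> I) + 4 * (D - 1) * s + 2 * s + 2 * s * D \<le> card U"
    and st: "host_emb (Rt \<union> I) {} col \<phi>0"
  shows "\<exists>\<phi>. host_emb (V0 \<union> I) E0 col \<phi> \<and> (\<forall>x\<in>Rt \<union> I. \<phi> x = \<phi>0 x)"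
proof -
  have finV0: "finite V0" using sg by (simp add: simple_graph_def)
  have E0: "\<exists>x y. x \<noteq> y \<and> e = {x, y} \<and> x \<in> V0 \<and> y \<in> V0" if "e \<in> E0" for e
    using sg that by (auto simp: simple_graph_def)
  have finE0: "finite E0"
    by (rule finite_subset[of _ "Pow V0"]) (use E0 finV0 in auto)
  \<comment> \<open>Roots must be reachable inside \<open>S\<close>, not merely inside
    \<open>V0\<close>; this is what puts two neighbours of the new vertex into one component of
    \<open>S\<close>.\<close>
  define P where "P S \<longleftrightarrow> Rt \<subseteq> S \<and> S \<subseteq> V0 \<and> (\<forall>x\<in>S. \<exists>\<rho>\<in>Rt. \<rho> \<in> comp S E0 x)
     \<and> (\<exists>\<phi>. host_emb (S \<union> I) {e \<in> E0. e \<subseteq> S} col \<phi> \<and> (\<forall>x\<in>Rt \<union> I. \<phi> x = \<phi>0 x))" for S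
  have noedge: "{e \<in> E0. e \<subseteq> Rt} = {}"
  proof (rule ccontr)
    assume "\<not> ?thesis"
    then obtain e where e: "e \<in> E0" "e \<subseteq> Rt" by auto
    obtain x y where "x \<noteq> y" "e = {x, y}" using E0[OF e(1)] by blast
    with e have xy: "{x, y} \<in> E0" "x \<noteq> y" "x \<in> Rt" "y \<in> Rt" by auto
    then have "x \<in> V0" "y \<in> V0" using Rt(1) by auto
    then show False using xy Rt(2)[of x] comp_refl[of x V0 E0] comp_edge[OF xy(1), of V0] by blast
  qed
  have "P Rt"
    using Rt(1) st comp_refl[of _ Rt E0] unfolding P_def noedge by blast
  moreover have "\<forall>S. P S \<longrightarrow> card S < Suc (card V0)"
    using finV0 by (auto simp: P_def less_Suc_eq_le intro: card_mono)
  ultimately obtain S where S: "P S" and max: "\<And>S'. P S' \<Longrightarrow> card S' \<le> card S"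
    using ex_has_greatest_nat[of P Rt card] by blast
  have SV: "Rt \<subseteq> S" "S \<subseteq> V0" and Sc: "\<And>x. x \<in> S \<Longrightarrow> \<exists>\<rho>\<in>Rt. \<rho> \<in> comp S E0 x"
    using S by (auto simp: P_def)
  have "S = V0"
  proof (rule ccontr)
    assume "S \<noteq> V0"
    then obtain x where x: "x \<in> V0" "x \<notin> S" using SV by auto
    then obtain \<rho> where "\<rho> \<in> Rt" "\<rho> \<in> comp V0 E0 x" using Rt(2) by blast
    then obtain xs where xs: "walk_in E0 xs" "set xs \<subseteq> V0" "hd xs = x" "last xs \<in> S"
      using SV by (auto simp: comp_def)
    have xne: "xs \<noteq> []" using xs(1) by (simp add: walk_in_def)
    \<comment> \<open>The walk leads from an uncovered vertex to a root. The vertex just before its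
      first entry into \<open>S\<close> is the one to attach.\<close>
    define j where "j = (LEAST j. j < length xs \<and> xs ! j \<in> S)"
    have "length xs - 1 < length xs \<and> xs ! (length xs - 1) \<in> S"
      using xs(4) xne by (simp add: last_conv_nth)
    then have j: "j < length xs" "xs ! j \<in> S"
      unfolding j_def by (metis (mono_tags, lifting) LeastI)+
    have "j \<noteq> 0" using j x xs(3) xne by (metis hd_conv_nth)
    then obtain i where i: "j = Suc i" by (cases j) auto
    define y u where "y = xs ! i" and "u = xs ! j"
    have "y \<notin> S"
      using not_less_Least[of i "\<lambda>j. j < length xs \<and> xs ! j \<in> S"] i j by (auto simp: j_def[symmetric] y_def)
    have yV: "y \<in> V0" using xs(2) i j by (auto simp: y_def)
    have uS: "u \<in> S" using j by (simp add: u_def)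
    have uy: "{u, y} \<in> E0"
      using xs(1) i j by (auto simp: walk_in_def u_def y_def insert_commute)
    have uniq: "u' = u" if u': "u' \<in> S" "{u', y} \<in> E0" for u'
    proof -
      obtain \<rho>1 \<rho>2 where \<rho>: "\<rho>1 \<in> Rt" "\<rho>1 \<in> comp S E0 u" "\<rho>2 \<in> Rt" "\<rho>2 \<in> comp S E0 u'"
        using Sc uS u' by blast
      have "u \<in> comp V0 E0 y" "u' \<in> comp V0 E0 y"
        using uy u' uS SV yV by (auto intro!: comp_edge simp: insert_commute)
      then have "\<rho>1 \<in> comp V0 E0 y" "\<rho>2 \<in> comp V0 E0 y"
        using \<rho> comp_mono[OF _ SV(2)] comp_trans by metis+
      then have "\<rho>1 = \<rho>2" using Rt(2)[OF yV] \<rho> by blast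
      then have "u' \<in> comp S E0 u" using \<rho> comp_sym comp_trans by metis
      then show ?thesis
        using acyclic_unique_edge[OF ac SV(2) yV \<open>y \<notin> S\<close> uy u'(2)] by simp
    qed
    define S' where "S' = insert y S"
    have edges: "{e \<in> E0. e \<subseteq> S'} = {e \<in> E0. e \<subseteq> S} \<union> path_edges [u, y]"
    proof -
      have pe: "path_edges [u, y] = {{u, y}}" by (auto simp: path_edges_def)
      have "e = {u, y}" if e: "e \<in> E0" "e \<subseteq> S'" "\<not> e \<subseteq> S" for e
      proof -
        obtain a b where ab: "a \<noteq> b" "e = {a, b}" using E0[OF e(1)] by blast
        then consider "a = y" "b \<in> S" | "b = y" "a \<in> S" using e by (auto simp: S'_def)
        then show ?thesis using uniq[of a] uniq[of b] e(1) ab by cases (auto simp: insert_commute)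
      qed
      moreover have "{u, y} \<subseteq> S'" "S \<subseteq> S'" using uS by (auto simp: S'_def)
      ultimately show ?thesis unfolding pe using uy by blast
    qed
    obtain \<phi> where \<phi>: "host_emb (S \<union> I) {e \<in> E0. e \<subseteq> S} col \<phi>" "\<forall>x\<in>Rt \<union> I. \<phi> x = \<phi>0 x"
      using S by (auto simp: P_def)
    have pe: "path_edges [u, y] \<subseteq> E0" using uy by (auto simp: path_edges_def)
    have S'V: "S' \<subseteq> V0" using SV yV by (simp add: S'_def)
    have VS: "S \<union> I \<union> set [u, y] = S' \<union> I" using uS by (auto simp: S'_def)
    have "card (S' \<union> I) \<le> card (V0 \<union> I)" using finV0 I S'V by (intro card_mono) auto
    then have rm: "card (S \<union> I \<union> set [u, y]) + 4 * (D - 1) * s + 2 * s + 2 * s * D \<le> card U"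
      unfolding VS using room by linarith
    have "\<exists>\<phi>'. host_emb (S \<union> I \<union> set [u, y]) ({e \<in> E0. e \<subseteq> S} \<union> path_edges [u, y]) col \<phi>'
        \<and> (\<forall>x\<in>S \<union> I. \<phi>' x = \<phi> x)"
    proof (rule host_emb_add_path[OF \<phi>(1) _ _ _ _ _ _ _ _ k rm])
      show "distinct [u, y]" using \<open>y \<notin> S\<close> uS by auto
      show "path_edges [u, y] \<inter> {e \<in> E0. e \<subseteq> S} = {}"
        using \<open>y \<notin> S\<close> by (auto simp: path_edges_def)
      show "col e \<in> {1..t}" if "e \<in> path_edges [u, y]" for e using that pe col by blast
      show "deg_col ({e \<in> E0. e \<subseteq> S} \<union> path_edges [u, y]) col i h \<le> D"
        if "h \<in> S \<union> I" "i \<in> {1..t}" for h i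
      proof (rule order_trans[OF deg_col_mono deg])
        show "{e \<in> E0. e \<subseteq> S} \<union> path_edges [u, y] \<subseteq> E0" using pe by auto
      qed (use that SV finE0 in auto)
      \<comment> \<open>Vacuous: the far end \<open>y\<close> is not embedded yet.\<close>
      show "2 * k + 4 \<le> length [u, y]" if "last [u, y] \<in> S \<union> I"
        using that \<open>y \<notin> S\<close> yV I by auto
    qed (use uS in auto)
    then obtain \<phi>' where \<phi>': "host_emb (S' \<union> I) {e \<in> E0. e \<subseteq> S'} col \<phi>'"
      "\<forall>x\<in>S \<union> I. \<phi>' x = \<phi> x"
      unfolding VS edges[symmetric] by blast
    have "\<exists>\<rho>\<in>Rt. \<rho> \<in> comp S' E0 x" if "x \<in> S'" for x
    proof -
      have SS: "S \<subseteq> S'" by (auto simp: S'_def)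
      have old: "\<exists>\<rho>\<in>Rt. \<rho> \<in> comp S' E0 x" if "x \<in> S" for x
        using Sc[OF that] comp_mono[OF _ SS] by blast
      have "u \<in> comp S' E0 y"
        using uy uS by (intro comp_edge) (auto simp: S'_def insert_commute)
      then have "\<exists>\<rho>\<in>Rt. \<rho> \<in> comp S' E0 y" using old[OF uS] comp_trans by metis
      then show ?thesis using old that by (auto simp: S'_def)
    qed
    moreover have "\<forall>x\<in>Rt \<union> I. \<phi>' x = \<phi>0 x" "Rt \<subseteq> S'" using \<phi>'(2) \<phi>(2) SV(1) by (auto simp: S'_def)
    ultimately have "P S'" unfolding P_def using \<phi>'(1) S'V by (intro conjI ballI exI[of _ \<phi>']) simp_all
    moreover have "card S' = Suc (card S)"
      unfolding S'_def using \<open>y \<notin> S\<close> finite_subset[OF SV(2) finV0] by simp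
    ultimately show False using max[of S'] by simp
  qed
  moreover have "{e \<in> E0. e \<subseteq> V0} = E0" using E0 by blast
  moreover have "\<exists>\<phi>. host_emb (S \<union> I) {e \<in> E0. e \<subseteq> S} col \<phi> \<and> (\<forall>x\<in>Rt \<union> I. \<phi> x = \<phi>0 x)"
    using S by (simp add: P_def)
  ultimately show ?thesis by (simp only:)
qed

lemma embed_paths:
  assumes st: "host_emb V1 E1 col \<phi>1"
    and Ps: "\<And>j. j < length Ps \<Longrightarrow> distinct (Ps ! j) \<and> 2 * k + 4 \<le> length (Ps ! j)"
    and inner: "\<And>j. j < length Ps \<Longrightarrow>
       set (butlast (tl (Ps ! j))) \<inter> (V1 \<union> (\<Union>i<j. set (Ps ! i))) = {}"
    and ends: "\<And>j. j < length Ps \<Longrightarrow> hd (Ps ! j) \<in> V1 \<union> (\<Union>i<j. set (Ps ! i))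
       \<or> last (Ps ! j) \<in> V1 \<union> (\<Union>i<j. set (Ps ! i))"
    and EH: "finite EH" "EH = E1 \<union> (\<Union>p\<in>set Ps. path_edges p)"
    and VH: "finite VH" "VH = V1 \<union> (\<Union>p\<in>set Ps. set p)"
    and col: "\<And>e. e \<in> EH \<Longrightarrow> col e \<in> {1..t}"
    and deg: "\<And>h i. h \<in> VH \<Longrightarrow> i \<in> {1..t} \<Longrightarrow> deg_col EH col i h \<le> D"
    and k: "s \<le> (D - 1) ^ k" "(D - 1) ^ k \<le> (D - 1) * s"
    and room: "card VH + 4 * (D - 1) * s + 2 * s + 2 * s * D \<le> card U"
  shows "\<exists>\<phi>. host_emb VH EH col \<phi> \<and> (\<forall>x\<in>V1. \<phi> x = \<phi>1 x)"
proof -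
  have "\<exists>\<phi>. host_emb (V1 \<union> (\<Union>i<j. set (Ps ! i))) (E1 \<union> (\<Union>i<j. path_edges (Ps ! i))) col \<phi>
      \<and> (\<forall>x\<in>V1. \<phi> x = \<phi>1 x)" if "j \<le> length Ps" for j
    using that
  proof (induction j)
    case 0
    then show ?case using st by auto
  next
    case (Suc j)
    define VC where "VC = V1 \<union> (\<Union>i<j. set (Ps ! i))"
    define EC where "EC = E1 \<union> (\<Union>i<j. path_edges (Ps ! i))"
    have jl: "j < length Ps" using Suc.prems by simp
    obtain \<phi> where \<phi>: "host_emb VC EC col \<phi>" "\<forall>x\<in>V1. \<phi> x = \<phi>1 x"
      using Suc unfolding VC_def EC_def by auto
    \<comment> \<open>Either end may be the embedded one; reversal puts it in front.\<close>
    define p where "p = (if hd (Ps ! j) \<in> VC then Ps ! j else rev (Ps ! j))"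
    have pne: "Ps ! j \<noteq> []" using Ps[OF jl] by auto
    have setp: "set p = set (Ps ! j)" and pep: "path_edges p = path_edges (Ps ! j)"
      and lenp: "length p = length (Ps ! j)" and distp: "distinct p"
      using Ps[OF jl] by (auto simp: p_def path_edges_rev)
    have "butlast (tl (rev (Ps ! j))) = rev (butlast (tl (Ps ! j)))"
      by (metis butlast_rev butlast_tl rev_rev_ident)
    then have intp: "set (butlast (tl p)) = set (butlast (tl (Ps ! j)))"
      by (simp add: p_def)
    have hdp: "hd p \<in> VC"
      using ends[OF jl] pne by (auto simp: p_def VC_def[symmetric] hd_rev)
    have len4: "2 * k + 4 \<le> length p" using Ps[OF jl] lenp by simp
    have int: "set (butlast (tl p)) \<inter> VC = {}" using inner[OF jl] intp by (simp add: VC_def)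
    have sub: "VC \<union> set p \<subseteq> VH"
      unfolding VH(2) VC_def setp using jl by (auto intro!: nth_mem)
    have subE: "EC \<union> path_edges p \<subseteq> EH"
      unfolding EH(2) EC_def pep using jl by (auto intro!: nth_mem)
    have "card (VC \<union> set p) \<le> card VH" using sub VH(1) by (intro card_mono) auto
    then have rm: "card (VC \<union> set p) + 4 * (D - 1) * s + 2 * s + 2 * s * D \<le> card U"
      using room by linarith
    have "\<exists>\<phi>'. host_emb (VC \<union> set p) (EC \<union> path_edges p) col \<phi>' \<and> (\<forall>x\<in>VC. \<phi>' x = \<phi> x)"
    proof (rule host_emb_add_path[OF \<phi>(1) distp _ hdp int _ _ _ len4 k rm])
      show "path_edges p \<inter> EC = {}"
      proof (rule ccontr)
        assume "path_edges p \<inter> EC \<noteq> {}"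
        then obtain e where e: "e \<in> path_edges p" "e \<in> EC" by auto
        then have "e \<subseteq> VC" using \<phi>(1) by (simp add: host_emb_def)
        then show False using path_edge_meets_internal[OF _ e(1)] len4 int by auto
      qed
      show "deg_col (EC \<union> path_edges p) col i h \<le> D" if "h \<in> VC" "i \<in> {1..t}" for h i
        by (rule order_trans[OF deg_col_mono[OF subE EH(1)] deg]) (use that sub in auto)
    qed (use len4 subE col in auto)
    moreover have "VC \<union> set p = V1 \<union> (\<Union>i<Suc j. set (Ps ! i))"
      unfolding VC_def setp by (auto simp: less_Suc_eq)
    moreover have "EC \<union> path_edges p = E1 \<union> (\<Union>i<Suc j. path_edges (Ps ! i))"
      unfolding EC_def pep by (auto simp: less_Suc_eq)
    ultimately show ?case using \<phi>(2) unfolding VC_def by fastforce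
  qed
  then show ?thesis unfolding EH(2) VH(2) UN_set_conv_nth by simp
qed

end

section \<open>Numerical bounds, the expanding core and the final assembly\<close>

text \<open>Rounding the logarithm up secures enough leaves, and rounding by at most 1 costs at most
  one factor \<open>D - 1\<close> in the size of the trees.\<close>

lemma power_log_ceiling_bounds:
  fixes s D :: nat
  assumes "1 \<le> s" "3 \<le> D"
  defines "k \<equiv> nat \<lceil>ln (real s) / ln (real D - 1)\<rceil>"
  shows "s \<le> (D - 1) ^ k" "(D - 1) ^ k \<le> (D - 1) * s"
proof -
  define q where "q = ln (real s) / ln (real D - 1)"
  have l: "0 < ln (real D - 1)" using assms by simp
  have D1: "real (D - 1) = real D - 1" using assms by simp
  have q0: "0 \<le> q" using l assms by (simp add: q_def)
  have k1: "q \<le> real k" using q0 unfolding k_def q_def[symmetric] by linarith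
  have k2: "real k \<le> q + 1" using q0 unfolding k_def q_def[symmetric] by linarith
  have pw: "real ((D - 1) ^ k) = exp (real k * ln (real D - 1))"
    using assms(1,2) by (simp add: exp_of_nat_mult D1)
  have sq: "real s = exp (q * ln (real D - 1))" using l assms by (simp add: q_def)
  have "real s \<le> real ((D - 1) ^ k)" unfolding pw sq using k1 l by simp
  then show "s \<le> (D - 1) ^ k" by linarith
  have "real ((D - 1) ^ k) \<le> exp ((q + 1) * ln (real D - 1))"
    unfolding pw using k2 l by simp
  also have "\<dots> = real s * (real D - 1)"
    using assms sq by (simp add: distrib_right exp_add)
  finally have "real ((D - 1) ^ k) \<le> real ((D - 1) * s)" using D1 by (simp add: mult.commute)
  then show "(D - 1) ^ k \<le> (D - 1) * s" by linarith
qed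

lemma rooted_all:
  assumes "simple_graph VH EH"
  shows "rooted VH EH VH"
proof -
  have ne: "nonroot_edges EH VH = {}"
    using assms by (auto simp: nonroot_edges_def simple_graph_def)
  have walk: "walk_in {} xs \<longleftrightarrow> length xs = 1" for xs :: "'a list"
    by (cases xs; cases "tl xs") (auto simp: walk_in_def)
  have comp: "comp VH {} x = {x}" if "x \<in> VH" for x
    using that unfolding comp_def walk by (auto simp: length_Suc_conv intro!: exI[of _ "[x]"])
  have "is_tree_on {x} {}" for x :: 'a
    unfolding is_tree_on_def acyclic_on_def cycle_on_def path_in_def walk
    by (auto intro!: exI[of _ "[x]"])
  then show ?thesis by (simp add: rooted_def ne comp)
qed

lemma expanding_core:
  assumes fam: "graph_family V t G" and join: "s_joined V t G s" and s: "1 \<le> s" and D: "3 \<le> D"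
    and Z: "Z \<subseteq> V" "card Z = 2 * s * D + 3 * s"
  obtains V' where "V' \<subseteq> V" "card V < card V' + s"
    "\<And>X. X \<subseteq> V' \<times> {1..t} \<Longrightarrow> card X \<le> s
      \<Longrightarrow> D * card X \<le> card (Gamma V' (restrict_fam G V') X \<inter> Z)"
proof -
  interpret joined_family V t s D G
    using assms by unfold_locales
  have finZ: "finite Z" using Z(1) by (rule finite_subset) simp
  have fin: "finite X" if "X \<subseteq> slots" for X using that by (rule finite_subset) auto
  \<comment> \<open>Neighbours among the vertices of \<open>B\<close> are discounted because these
    vertices will be deleted. Having fewer than \<open>s\<close> slots, \<open>B\<close> deletes
    fewer than \<open>s\<close> vertices.\<close>
  define P where "P B \<longleftrightarrow> B \<subseteq> slots \<and> card B < s \<and> card (nbh B \<inter> Z - fst ` B) \<le> D * card B" for B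
  have "P {}" using s by (simp add: P_def)
  moreover have "\<forall>B. P B \<longrightarrow> card B < s" by (simp add: P_def)
  ultimately obtain B where B: "P B" and max: "\<And>B'. P B' \<Longrightarrow> card B' \<le> card B"
    using ex_has_greatest_nat[of P "{}" card s] by blast
  define V' where "V' = V - fst ` B"
  have Bs: "B \<subseteq> slots" "card B < s" and Bc: "card (nbh B \<inter> Z - fst ` B) \<le> D * card B"
    using B by (auto simp: P_def)
  have finB: "finite B" using fin Bs by blast
  have "card (fst ` B) \<le> card B" using finB by (rule card_image_le)
  moreover have "card V' = card V - card (fst ` B)"
    unfolding V'_def using Bs finB by (intro card_Diff_subset) auto
  moreover have "card (fst ` B) \<le> card V" using Bs by (intro card_mono) auto
  ultimately have cV': "card V < card V' + s" using Bs(2) by linarith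
  have "D * card X \<le> card (Gamma V' (restrict_fam G V') X \<inter> Z)"
    if X: "X \<subseteq> V' \<times> {1..t}" "card X \<le> s" for X
  proof (rule ccontr)
    assume "\<not> ?thesis"
    then have small: "card (Gamma V' (restrict_fam G V') X \<inter> Z) < D * card X" by simp
    have Xs: "X \<subseteq> slots" using X(1) by (auto simp: V'_def)
    have finX: "finite X" using fin Xs by blast
    have disj: "B \<inter> X = {}" using X(1) by (force simp: V'_def)
    \<comment> \<open>Bad expansion is additive: a violating \<open>X\<close> in the rest would make
      \<open>C\<close> bad as well, which contradicts maximality if \<open>C\<close> is small and
      joinedness if it is large.\<close>
    define C where "C = B \<union> X"
    have Cs: "C \<subseteq> slots" using Bs Xs by (simp add: C_def)
    have finC: "finite C" using fin Cs by blast
    have cC: "card C = card B + card X" unfolding C_def using finB finX disj by (rule card_Un_disjoint)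
    have sub: "nbh C \<inter> Z - fst ` C \<subseteq> (nbh B \<inter> Z - fst ` B) \<union> (Gamma V' (restrict_fam G V') X \<inter> Z)"
    proof
      fix y assume y: "y \<in> nbh C \<inter> Z - fst ` C"
      then have yB: "y \<in> V'" by (auto simp: V'_def C_def Gamma_def)
      from y obtain v i where vi: "(v, i) \<in> C" "G i v y" by (auto simp: Gamma_def)
      show "y \<in> (nbh B \<inter> Z - fst ` B) \<union> (Gamma V' (restrict_fam G V') X \<inter> Z)"
      proof (cases "(v, i) \<in> B")
        case True
        then show ?thesis using vi y yB by (auto simp: Gamma_def V'_def)
      next
        case False
        then have "(v, i) \<in> X" "v \<in> V'" using vi X(1) by (auto simp: C_def)
        then show ?thesis using vi y yB by (auto simp: Gamma_def restrict_fam_def)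
      qed
    qed
    have "card (nbh C \<inter> Z - fst ` C)
        \<le> card ((nbh B \<inter> Z - fst ` B) \<union> (Gamma V' (restrict_fam G V') X \<inter> Z))"
      using finZ sub by (intro card_mono) auto
    also have "\<dots> \<le> card (nbh B \<inter> Z - fst ` B) + card (Gamma V' (restrict_fam G V') X \<inter> Z)"
      by (rule card_Un_le)
    also have "\<dots> \<le> D * card C" using Bc small cC by (simp add: distrib_left)
    finally have Cc: "card (nbh C \<inter> Z - fst ` C) \<le> D * card C" .
    show False
    proof (cases "card C < s")
      case True
      then have "P C" using Cs Cc by (simp add: P_def)
      moreover have "0 < card X" using small by (cases "card X") auto
      ultimately show False using max[of C] cC by simp
    next
      case False
      have cl: "card V < card (nbh C) + s" using card_nbh_large[OF Cs] False by simp
      have "card (V - nbh C) = card V - card (nbh C)"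
        by (rule card_Diff_subset) (auto simp: Gamma_def)
      then have cl': "card (V - nbh C) < s" using cl s by linarith
      \<comment> \<open>Origin of the size of \<open>Z\<close>: it would be covered by at most
        \<open>D * card C\<close> neighbours, fewer than \<open>s\<close> non-neighbours and at most
        \<open>card C\<close> vertices of \<open>C\<close>. With \<open>card C \<le> 2 * s\<close>
        this is less than \<open>2sD + 3s\<close>.\<close>
      have "Z \<subseteq> (nbh C \<inter> Z - fst ` C) \<union> (V - nbh C) \<union> fst ` C" using Z(1) by auto
      then have "card Z \<le> card ((nbh C \<inter> Z - fst ` C) \<union> (V - nbh C) \<union> fst ` C)"
        using finZ finC by (intro card_mono) auto
      also have "\<dots> \<le> card (nbh C \<inter> Z - fst ` C) + card (V - nbh C) + card (fst ` C)"
        by (meson add_le_mono1 card_Un_le order_trans)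
      also have "card (fst ` C) \<le> card C" using finC by (rule card_image_le)
      finally have "card Z < D * card C + s + card C" using Cc cl' by linarith
      moreover have "card C \<le> 2 * s" using cC X(2) Bs(2) by simp
      moreover from this have "D * card C \<le> D * (2 * s)" by (rule mult_left_mono) simp
      ultimately show False using Z(2) by (simp add: mult.commute mult.left_commute)
    qed
  qed
  then show thesis using that[of V'] cV' by (auto simp: V'_def)
qed

theorem theorem3p4:
  fixes V :: "'v set" and G :: "nat \<Rightarrow> 'v \<Rightarrow> 'v \<Rightarrow> bool"
    and r s t D n :: nat
    and VH :: "'h set" and EH :: "'h set set" and V0 :: "'h set" and E0 :: "'h set set"
    and hroot :: "nat \<Rightarrow> 'h" and col :: "'h set \<Rightarrow> nat"
  assumes "r \<ge> 1" and "s \<ge> 1" and "t \<ge> 1" and "D \<ge> 3"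
    and "graph_family V t G" and "card V = n" and "s_joined V t G s"
    and "simple_graph VH EH"
    and "simple_graph V0 E0" and "V0 \<subseteq> VH" and "E0 \<subseteq> EH"
    and "acyclic_on V0 E0"
    and "\<forall>i\<in>{1..r}. hroot i \<in> V0"
    and "\<forall>x\<in>V0. \<exists>!i. i \<in> {1..r} \<and> hroot i \<in> comp V0 E0 x"
    and "\<exists>Ps. path_construction V0 E0 VH EH Ps \<and>
           (\<forall>p\<in>set Ps. length p - 1 \<ge> 2 * nat \<lceil>ln (real s) / ln (real D - 1)\<rceil> + 3)"
    and "int (card VH) \<le> int n - 6 * int s * int D"
    and "edge_coloring VH EH t col"
    and "max_mon_deg_le VH EH t col D"
  shows "\<exists>W V'. W \<subseteq> V' \<and> V' \<subseteq> V \<and> int (card V') \<ge> int n - int s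
           \<and> int (card W) \<ge> int n - 3 * int s * int D - 5 * int s
           \<and> (\<forall>v :: nat \<Rightarrow> 'v. (\<forall>i\<in>{1..r}. v i \<in> W) \<and> inj_on v {1..r} \<longrightarrow>
                (\<exists>R. hroot ` {1..r} \<subseteq> R \<and> rooted VH EH R \<and>
                   (\<exists>\<phi>. embedding VH EH col V' (restrict_fam G V') \<phi>
                        \<and> good (2 * s) D t V' (restrict_fam G V') VH EH col R \<phi>
                        \<and> (\<forall>i\<in>{1..r}. \<phi> (hroot i) = v i))))"
proof -
  have s: "1 \<le> s" and D: "3 \<le> D" and n: "card V = n" using assms by auto
  define k where "k = nat \<lceil>ln (real s) / ln (real D - 1)\<rceil>"
  have k: "s \<le> (D - 1) ^ k" "(D - 1) ^ k \<le> (D - 1) * s"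
    using power_log_ceiling_bounds[OF s D] by (simp_all add: k_def)
  obtain Ps where pc: "path_construction V0 E0 VH EH Ps"
    and long: "\<And>p. p \<in> set Ps \<Longrightarrow> 2 * k + 3 \<le> length p - 1"
    using assms(15) by (auto simp: k_def)
  have finVH: "finite VH" and finEH: "finite EH" and finV: "finite V"
  proof -
    show "finite VH" "finite V" using assms(5,8) by (auto simp: simple_graph_def graph_family_def)
    then show "finite EH"
      by (intro finite_subset[of EH "Pow VH"]) (use assms(8) in \<open>auto simp: simple_graph_def\<close>)
  qed
  have "int (card VH + 6 * (s * D)) \<le> int n" using assms(16) by (simp add: algebra_simps)
  then have cVH: "card VH + 6 * (s * D) \<le> n" by linarith
  have sD: "3 * s \<le> s * D" using D by (simp add: mult.commute)
  have "2 * s * D + 3 * s \<le> card V" using cVH sD n by linarith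
  then obtain Z where Z: "Z \<subseteq> V" "card Z = 2 * s * D + 3 * s"
    by (meson obtain_subset_with_card_n)
  obtain V' where V': "V' \<subseteq> V" "card V < card V' + s"
    and core: "\<And>X. X \<subseteq> V' \<times> {1..t} \<Longrightarrow> card X \<le> s
      \<Longrightarrow> D * card X \<le> card (Gamma V' (restrict_fam G V') X \<inter> Z)"
    using expanding_core[OF assms(5,7) s D Z] by blast
  interpret joined_family V' t s D "restrict_fam G V'"
  proof
    show "graph_family V' t (restrict_fam G V')"
      using assms(5) finite_subset[OF V'(1) finV] by (auto simp: graph_family_def restrict_fam_def)
    show "s_joined V' t (restrict_fam G V') s"
      unfolding s_joined_def
    proof (intro allI impI)
      fix X Y assume X: "X \<subseteq> V' \<times> {1..t}" and Y: "Y \<subseteq> V'" and "s \<le> card X" "s \<le> card Y"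
      moreover from X Y V'(1) have "X \<subseteq> V \<times> {1..t}" "Y \<subseteq> V" by auto
      ultimately have "\<exists>(v, i)\<in>X. \<exists>y\<in>Y. G i v y" using assms(7) unfolding s_joined_def by blast
      then show "\<exists>(v, i)\<in>X. \<exists>y\<in>Y. restrict_fam G V' i v y"
        using X Y unfolding restrict_fam_def by fast
    qed
  qed (use s D in auto)
  define W where "W = V' - Z"
  have finZ: "finite Z" using Z(1) finV by (rule finite_subset)
  have "card V' - card Z \<le> card W" unfolding W_def using finZ by (rule diff_card_le_card_Diff)
  then have cW: "n \<le> card W + s + 2 * (s * D) + 3 * s" using V'(2) n Z(2) by linarith
  have D1: "4 * (D - 1) * s + 4 * s = 4 * (s * D)" using D by (cases D) (auto simp: algebra_simps)
  have room: "card VH + 4 * (D - 1) * s + 2 * s + 2 * s * D \<le> card V'"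
    using cVH D1 V'(2) n by linarith
  \<comment> \<open>\<open>I\<close> consists of the isolated vertices outside the forest and all
    paths. They need images too and are placed in \<open>W\<close> together with the roots.\<close>
  define Rt I where "Rt = hroot ` {1..r}" and "I = VH - V0 - (\<Union>p\<in>set Ps. set p)"
  have hinj: "inj_on hroot {1..r}"
  proof (rule inj_onI)
    fix i j assume ij: "i \<in> {1..r}" "j \<in> {1..r}" "hroot i = hroot j"
    then have "hroot i \<in> V0" using assms(13) by blast
    then show "i = j" using assms(14) ij comp_refl[of "hroot i" V0 E0] by metis
  qed
  have RtV: "Rt \<subseteq> V0" using assms(13) by (auto simp: Rt_def)
  have uniq: "\<exists>!\<rho>. \<rho> \<in> Rt \<and> \<rho> \<in> comp V0 E0 x" if x: "x \<in> V0" for x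
  proof -
    obtain i where i: "i \<in> {1..r}" "hroot i \<in> comp V0 E0 x"
      and iu: "\<And>j. j \<in> {1..r} \<Longrightarrow> hroot j \<in> comp V0 E0 x \<Longrightarrow> j = i"
      using assms(14) x by blast
    show ?thesis
    proof (rule ex1I[of _ "hroot i"])
      show "hroot i \<in> Rt \<and> hroot i \<in> comp V0 E0 x" using i by (simp add: Rt_def)
      show "\<rho> = hroot i" if "\<rho> \<in> Rt \<and> \<rho> \<in> comp V0 E0 x" for \<rho>
        using that iu by (auto simp: Rt_def)
    qed
  qed
  have finI: "finite I" and IV: "I \<inter> V0 = {}" and IVH: "I \<subseteq> VH" and RtI: "Rt \<inter> I = {}"
    using finVH RtV by (auto simp: I_def)
  have paths: "distinct p" "set p \<subseteq> VH" if "p \<in> set Ps" for p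
    using pc that by (auto simp: path_construction_def path_in_def)
  have VHeq: "VH = V0 \<union> I \<union> (\<Union>p\<in>set Ps. set p)"
    using assms(10) paths(2) by (auto simp: I_def)
  have EHeq: "EH = E0 \<union> (\<Union>p\<in>set Ps. path_edges p)"
    using pc by (simp add: path_construction_def)
  have col: "col e \<in> {1..t}" if "e \<in> EH" for e using assms(17) that by (simp add: edge_coloring_def)
  have deg: "deg_col EH col i h \<le> D" if "h \<in> VH" "i \<in> {1..t}" for h i
    using assms(18) that by (simp add: max_mon_deg_le_def)
  have main: "\<exists>\<phi>. embedding VH EH col V' (restrict_fam G V') \<phi>
      \<and> good (2 * s) D t V' (restrict_fam G V') VH EH col VH \<phi> \<and> (\<forall>i\<in>{1..r}. \<phi> (hroot i) = v i)"
    if v: "\<forall>i\<in>{1..r}. v i \<in> W" "inj_on v {1..r}" for v :: "nat \<Rightarrow> 'v"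
  proof -
    have "card (Rt \<union> I) \<le> card VH" using finVH RtV assms(10) IVH by (intro card_mono) auto
    moreover have "card (Rt \<union> I) = card Rt + card I"
      using finI RtI by (intro card_Un_disjoint) (auto simp: Rt_def)
    moreover have "card Rt = r" unfolding Rt_def using hinj by (simp add: card_image)
    ultimately have cRI: "card (Rt \<union> I) = r + card I" "r + card I \<le> card VH" by auto
    have vW: "v ` {1..r} \<subseteq> W" using v(1) by auto
    have finW: "finite W" by (simp add: W_def)
    have "card (W - v ` {1..r}) = card W - r"
      using vW v(2) by (subst card_Diff_subset) (auto simp: card_image)
    \<comment> \<open>\<open>W\<close> misses at most \<open>2sD + 4s\<close> of the
      \<open>n\<close> vertices, which is below the \<open>6sD\<close> that the coloured graph
      leaves free.\<close>
    then have "card I \<le> card (W - v ` {1..r})" using cRI(2) cW cVH sD by linarith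
    then obtain f where f: "f ` I \<subseteq> W - v ` {1..r}" "inj_on f I"
      using card_le_inj[OF finI, of "W - v ` {1..r}"] finW by auto
    define \<phi>0 where "\<phi>0 x = (if x \<in> I then f x else v (inv_into {1..r} hroot x))" for x
    have \<phi>R: "\<phi>0 (hroot i) = v i" if "i \<in> {1..r}" for i
    proof -
      have "hroot i \<notin> I" using that RtI unfolding Rt_def by blast
      then show ?thesis using that hinj by (simp add: \<phi>0_def)
    qed
    have \<phi>I: "\<phi>0 x = f x" if "x \<in> I" for x using that by (simp add: \<phi>0_def)
    have "inj_on (\<phi>0 \<circ> hroot) {1..r}"
      using v(2) inj_on_cong[of "{1..r}" "\<phi>0 \<circ> hroot" v] \<phi>R by simp
    then have i1: "inj_on \<phi>0 Rt" unfolding Rt_def by (rule inj_on_imageI)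
    have i2: "inj_on \<phi>0 I" using f(2) inj_on_cong[of I \<phi>0 f] \<phi>I by simp
    have e1: "\<phi>0 ` Rt = v ` {1..r}" unfolding Rt_def image_image by (intro image_cong refl \<phi>R)
    have e2: "\<phi>0 ` I = f ` I" by (intro image_cong refl \<phi>I)
    have img0: "\<phi>0 ` (Rt \<union> I) \<subseteq> W" unfolding image_Un e1 e2 using f(1) vW by blast
    have "\<phi>0 ` Rt \<inter> \<phi>0 ` I = {}" unfolding e1 e2 using f(1) by blast
    then have inj0: "inj_on \<phi>0 (Rt \<union> I)" using i1 i2 unfolding inj_on_Un by blast
    define A where "A = \<phi>0 ` (Rt \<union> I)"
    have cA: "card A = r + card I" unfolding A_def using inj0 cRI by (simp add: card_image)
    have finA: "finite A" using finI by (simp add: A_def Rt_def)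
    have rA: "card A + s + 2 * s * D \<le> card V'" using cA cRI(2) cVH sD V'(2) n by linarith
    have "expands A (\<lambda>_. int D)"
      unfolding expands_def
    proof (intro allI impI)
      fix X assume X: "X \<subseteq> slots" "card X \<le> 2 * s"
      \<comment> \<open>Up to \<open>s\<close> slots expand into \<open>Z\<close>, which
        \<open>A\<close> avoids; beyond \<open>s\<close> slots joinedness suffices.\<close>
      show "(\<Sum>_\<in>X. int D) \<le> int (card (nbh X - A))"
      proof (cases "card X \<le> s")
        case True
        have "card (nbh X \<inter> Z) \<le> card (nbh X - A)"
          using img0 by (intro card_mono) (auto simp: A_def W_def)
        then have "D * card X \<le> card (nbh X - A)" using core[OF X(1) True] by linarith
        then have "int (D * card X) \<le> int (card (nbh X - A))" by linarith
        then show ?thesis by (simp add: mult.commute)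
      next
        case False
        then show ?thesis
          using sum_less_card_nbh_large[OF X(1) _ X(2), of "\<lambda>_. int D" A] finA rA by simp
      qed
    qed
    then have "expands A (\<lambda>(v, i). int D - int (deg_img (Rt \<union> I) {} col \<phi>0 v i))"
      by (rule expands_mono) auto
    then have st0: "host_emb (Rt \<union> I) {} col \<phi>0"
      using inj0 img0 finI unfolding host_emb_def embedding_def A_def W_def by (auto simp: Rt_def)
    have "card (V0 \<union> I) \<le> card VH" using finVH assms(10) IVH by (intro card_mono) auto
    then have room0: "card (V0 \<union> I) + 4 * (D - 1) * s + 2 * s + 2 * s * D \<le> card V'"
      using room by linarith
    have deg0: "deg_col E0 col i h \<le> D" if "h \<in> V0 \<union> I" "i \<in> {1..t}" for h i
      by (rule order_trans[OF deg_col_mono[OF assms(11) finEH] deg]) (use that assms(10) IVH in auto)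
    have "\<exists>\<phi>. host_emb (V0 \<union> I) E0 col \<phi> \<and> (\<forall>x\<in>Rt \<union> I. \<phi> x = \<phi>0 x)"
      by (rule embed_forest[OF assms(9,12) RtV uniq finI IV _ deg0 k room0 st0])
        (use col assms(11) in auto)
    then obtain \<phi>1 where \<phi>1: "host_emb (V0 \<union> I) E0 col \<phi>1" "\<forall>x\<in>Rt \<union> I. \<phi>1 x = \<phi>0 x" by blast
    have "\<exists>\<phi>. host_emb VH EH col \<phi> \<and> (\<forall>x\<in>V0 \<union> I. \<phi> x = \<phi>1 x)"
    proof (rule embed_paths[OF \<phi>1(1) _ _ _ finEH EHeq finVH VHeq col deg k room])
      fix j assume j: "j < length Ps"
      then have Pj: "Ps ! j \<in> set Ps" by simp
      show "distinct (Ps ! j) \<and> 2 * k + 4 \<le> length (Ps ! j)"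
        using paths(1)[OF Pj] long[OF Pj] by simp
      have "set (butlast (tl (Ps ! j))) \<subseteq> set (Ps ! j)"
        by (cases "Ps ! j") (auto dest: in_set_butlastD)
      \<comment> \<open>No path vertex lies in \<open>I\<close>, so placing \<open>I\<close> early
        cannot collide with the inside of a path.\<close>
      then have "set (butlast (tl (Ps ! j))) \<inter> I = {}" using Pj by (auto simp: I_def)
      moreover have "set (butlast (tl (Ps ! j))) \<inter> (V0 \<union> (\<Union>i<j. set (Ps ! i))) = {}"
        using pc j by (simp add: path_construction_def)
      ultimately show "set (butlast (tl (Ps ! j))) \<inter> (V0 \<union> I \<union> (\<Union>i<j. set (Ps ! i))) = {}"
        by blast
      show "hd (Ps ! j) \<in> V0 \<union> I \<union> (\<Union>i<j. set (Ps ! i)) \<or> last (Ps ! j) \<in> V0 \<union> I \<union> (\<Union>i<j. set (Ps ! i))"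
        using pc j unfolding path_construction_def by blast
    qed
    then obtain \<phi> where \<phi>: "host_emb VH EH col \<phi>" "\<forall>x\<in>V0 \<union> I. \<phi> x = \<phi>1 x" by blast
    have "\<phi> (hroot i) = v i" if "i \<in> {1..r}" for i
    proof -
      have "hroot i \<in> Rt" using that by (simp add: Rt_def)
      then show ?thesis using \<phi>(2) \<phi>1(2) \<phi>R[OF that] RtV by auto
    qed
    \<comment> \<open>There is no non-root, and \<open>R\<close> loses its last term; what remains
      is the inequality of \<open>expands\<close>.\<close>
    moreover have "P_set VH EH col VH \<phi> = {}" by (simp add: P_set_def)
    then have "good (2 * s) D t V' (restrict_fam G V') VH EH col VH \<phi>"
      using \<phi>(1) unfolding host_emb_def expands_def good_def R_val_def by simp
    ultimately show ?thesis using \<phi>(1) unfolding host_emb_def by blast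
  qed
  show ?thesis
  proof (rule exI[of _ W], rule exI[of _ V'], intro conjI allI impI)
    show "W \<subseteq> V'" "V' \<subseteq> V" using V' by (auto simp: W_def)
    show "int n - int s \<le> int (card V')" using V'(2) n by linarith
    have "n \<le> card W + 3 * (s * D) + 5 * s" using cW by linarith
    then have "int n \<le> int (card W + 3 * (s * D) + 5 * s)" by linarith
    then show "int n - 3 * int s * int D - 5 * int s \<le> int (card W)" by (simp add: algebra_simps)
    fix v :: "nat \<Rightarrow> 'v"
    assume "(\<forall>i\<in>{1..r}. v i \<in> W) \<and> inj_on v {1..r}"
    then obtain \<phi> where "embedding VH EH col V' (restrict_fam G V') \<phi>
      \<and> good (2 * s) D t V' (restrict_fam G V') VH EH col VH \<phi> \<and> (\<forall>i\<in>{1..r}. \<phi> (hroot i) = v i)"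
      using main by blast
    moreover have "hroot ` {1..r} \<subseteq> VH" using assms(10,13) by auto
    ultimately show "\<exists>R. hroot ` {1..r} \<subseteq> R \<and> rooted VH EH R \<and>
        (\<exists>\<phi>. embedding VH EH col V' (restrict_fam G V') \<phi>
          \<and> good (2 * s) D t V' (restrict_fam G V') VH EH col R \<phi>
          \<and> (\<forall>i\<in>{1..r}. \<phi> (hroot i) = v i))"
      using rooted_all[OF assms(8)] by blast
  qed
qed

end
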